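(* Let $\mathcal P$ and $\mathcal P_\epsilon$ be Markov kernels on a Polish space $\mathbf X$, let $V:\mathbf X\to[0,\infty)$ be continuous, and suppose $V$ is a Lyapunov function of $\mathcal P$ (with some constants $\gamma\in(0,1)$, $K>0$) and of $\mathcal P_\epsilon$ with constants $\gamma_\epsilon\in(0,1)$, $K_\epsilon>0$. Let $d:\mathbf X\times\mathbf X\to[0,1]$ be distance-like, and let $\beta>0$, $\bar\alpha\in(0,1)$ and $C<\infty$ be such that $$\tilde d_\beta(\delta_x\mathcal P,\delta_y\mathcal P)\le\bar\alpha\,\tilde d_\beta(x,y)\quad\text{and}\quad \tilde d_\beta(x,y)\le C\big(\tilde d_\beta(x,z)+\tilde d_\beta(z,y)\big)\qquad\text{for all }x,y,z\in\mathbf X.$$ Let $\epsilon>0$ and $\delta\ge0$. Suppose there exist a function $c:\mathbb N\to[0,\infty)$ and a Lyapunov function $\tilde V\le V+\frac{K_\epsilon}{1-\gamma_\epsilon}$ of $\mathcal P$ and $\mathcal P_\epsilon$ such that for each $n>0$ and all $x\in\mathbf X$, $$\tilde d_\beta(\delta_x\mathcal P^n,\delta_x\mathcal P_\epsilon^n)\le\epsilon\, c(n)\,(1+\delta\tilde V(x)).\qquad( * )$$ Then: (a) for any $\bar\alpha^*\in(0,1)$ there exists $n>(-\log C)(\log\bar\alpha)^{-1}$ such that for all probability measures $\mu,\nu$ on $\mathbf X$, $$\tilde d_\beta(\nu\mathcal P^n,\mu\mathcal P_\epsilon^n)\le\bar\alpha^*\,\tilde d_\beta(\mu,\nu)+\epsilon\,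 C\, c(n)\,(1+\delta\,\mu\tilde V);$$ (b) if $\mu,\mu_\epsilon$ are any invariant probability measures of $\mathcal P,\mathcal P_\epsilon$ respectively, then for any $n$ such that $\bar\alpha^n<C^{-1}$, $$\tilde d_\beta(\mu,\mu_\epsilon)\le\frac{C\,\epsilon\, c(n)}{1-C\bar\alpha^n}\,(1+\delta\,\mu_\epsilon\tilde V).$$ (c) In particular, if $\tilde d_\beta(\delta_x\mathcal P,\delta_x\mathcal P_\epsilon)\le\epsilon(1+\delta V(x))$ for all $x\in\mathbf X$, then one can take $c(n)=\sum_{j=1}^nC^j\bar\alpha^{j-1}$ (that is, there exists a Lyapunov function $\tilde V\le V+\frac{K_\epsilon}{1-\gamma_\epsilon}$ of $\mathcal P$ and $\mathcal P_\epsilon$ such that $\tilde d_\beta(\delta_x\mathcal P^n,\delta_x\mathcal P_\epsilon^n)\le\epsilon\,c(n)\,(1+\delta\tilde V(x))$ for each $n>0$ and all $x\in\mathbf X$, with this $c$), so that no additional assumptions are needed.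
   Context: $\delta_x\mathcal P=\mathcal P(x,\cdot)$, $(\mathcal PV)(x)=\int V(y)\,\mathcal P(x,dy)$, $\mu V=\int V\,d\mu$. A function $V:\mathbf X\to[0,\infty)$ is a Lyapunov function of $\mathcal P$ with constants $\gamma\in(0,1)$, $K>0$ if $(\mathcal PV)(x)\le\gamma V(x)+K$ for all $x$. A function $d:\mathbf X\times\mathbf X\to\mathbb R_+$ is distance-like if it is symmetric, lower semicontinuous, and $d(x,y)=0\Leftrightarrow x=y$. For $\beta>0$, $\tilde d_\beta(x,y)=\sqrt{d(x,y)\,(2+\beta V(x)+\beta V(y))}$, and for probability measures $\tilde d_\beta(\mu,\nu)=\inf_\Gamma\int_{\mathbf X\times\mathbf X}\tilde d_\beta(x,y)\,\Gamma(dx,dy)$ over all couplings $\Gamma$ of $\mu$ and $\nu$. *)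

theory Defs
  imports "HOL-Probability.Probability"
begin

text \<open>A Markov kernel on a topological space is a measurable map
  \<open>P \<in> borel \<rightarrow>\<^sub>M prob_algebra borel\<close>; its action \<open>\<mu>P\<close> on a measure is \<open>\<mu> \<bind> P\<close>, and \<open>\<delta>\<^sub>x P\<close>
  is \<open>P x\<close>. All integrals of nonnegative functions are taken in \<open>ennreal\<close>, so they may be infinite.\<close>

primrec kernel_pow :: "('a::topological_space \<Rightarrow> 'a measure) \<Rightarrow> nat \<Rightarrow> 'a \<Rightarrow> 'a measure" where
  "kernel_pow P 0 = return borel"
| "kernel_pow P (Suc n) = (\<lambda>x. kernel_pow P n x \<bind> P)"

definition lyapunov_with ::
    "('a::topological_space \<Rightarrow> 'a measure) \<Rightarrow> ('a \<Rightarrow> real) \<Rightarrow> real \<Rightarrow> real \<Rightarrow> bool" where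
  "lyapunov_with P V \<gamma> K \<longleftrightarrow>
     V \<in> borel_measurable borel \<and> (\<forall>x. 0 \<le> V x) \<and> 0 < \<gamma> \<and> \<gamma> < 1 \<and> 0 < K \<and>
     (\<forall>x. (\<integral>\<^sup>+y. ennreal (V y) \<partial>P x) \<le> ennreal (\<gamma> * V x + K))"

definition lyapunov :: "('a::topological_space \<Rightarrow> 'a measure) \<Rightarrow> ('a \<Rightarrow> real) \<Rightarrow> bool" where
  "lyapunov P V \<longleftrightarrow> (\<exists>\<gamma> K. lyapunov_with P V \<gamma> K)"

definition lower_semicontinuous :: "('a::topological_space \<Rightarrow> real) \<Rightarrow> bool" where
  "lower_semicontinuous f \<longleftrightarrow> (\<forall>x. \<forall>a < f x. \<forall>\<^sub>F y in nhds x. a < f y)"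

definition distance_like :: "('a::topological_space \<Rightarrow> 'a \<Rightarrow> real) \<Rightarrow> bool" where
  "distance_like d \<longleftrightarrow>
     (\<forall>x y. 0 \<le> d x y) \<and> (\<forall>x y. d x y = d y x) \<and>
     lower_semicontinuous (\<lambda>(x, y). d x y) \<and> (\<forall>x y. d x y = 0 \<longleftrightarrow> x = y)"

definition tilde_dist :: "('a \<Rightarrow> 'a \<Rightarrow> real) \<Rightarrow> ('a \<Rightarrow> real) \<Rightarrow> real \<Rightarrow> 'a \<Rightarrow> 'a \<Rightarrow> real" where
  "tilde_dist d V \<beta> x y = sqrt (d x y * (2 + \<beta> * V x + \<beta> * V y))"

definition couplings :: "'a measure \<Rightarrow> 'b measure \<Rightarrow> ('a \<times> 'b) measure set" where
  "couplings \<mu> \<nu> = {\<Gamma>. prob_space \<Gamma> \<and> sets \<Gamma> = sets (\<mu> \<Otimes>\<^sub>M \<nu>) \<and>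
                       distr \<Gamma> \<mu> fst = \<mu> \<and> distr \<Gamma> \<nu> snd = \<nu>}"

definition tilde_dist_measure ::
    "('a \<Rightarrow> 'a \<Rightarrow> real) \<Rightarrow> ('a \<Rightarrow> real) \<Rightarrow> real \<Rightarrow> 'a measure \<Rightarrow> 'a measure \<Rightarrow> ennreal" where
  "tilde_dist_measure d V \<beta> \<mu> \<nu> =
     (INF \<Gamma>\<in>couplings \<mu> \<nu>. \<integral>\<^sup>+(x, y). ennreal (tilde_dist d V \<beta> x y) \<partial>\<Gamma>)"

definition invariant_prob :: "('a::topological_space \<Rightarrow> 'a measure) \<Rightarrow> 'a measure \<Rightarrow> bool" where
  "invariant_prob P \<mu> \<longleftrightarrow> \<mu> \<in> space (prob_algebra borel) \<and> \<mu> \<bind> P = \<mu>"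

end

theory Submission
  imports Defs
begin

text \<open>
  Write \<open>T\<close> for the transport cost with cost function \<open>tilde_dist d V \<beta>\<close>. Three properties of \<open>T\<close> give
  everything. It is convex under mixtures: if \<open>T (K z) (L z) \<le> f z\<close> for all \<open>z\<close>, then the mixtures of
  \<open>K\<close> and \<open>L\<close> over a probability measure have cost at most the integral of \<open>f\<close>
  (\<open>transport_cost_bind_le\<close>). It inherits the weak triangle inequality with the same constant \<open>C\<close>
  (\<open>transport_cost_weak_triangle\<close>). And it is symmetric.

  Applied to a coupling of \<open>\<nu>\<close> and \<open>\<mu>\<close>, the first property turns the pointwise contraction of \<open>P\<close> into
  \<open>T (\<nu>P\<^sup>n) (\<mu>P\<^sup>n) \<le> \<alpha>\<^sup>n T \<nu> \<mu>\<close>. Applied to \<open>\<mu>\<close> itself, it turns the pointwise error bound on the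
  \<open>n\<close>-step kernels into a bound for \<open>T (\<mu>P\<^sup>n) (\<mu>P\<epsilon>\<^sup>n)\<close>. Passing through \<open>\<mu>P\<^sup>n\<close> with the
  triangle inequality costs a factor \<open>C\<close>, and (a) follows for every \<open>n\<close> with \<open>C\<alpha>\<^sup>n\<close> small. For invariant
  measures the left-hand side reappears on the right with coefficient \<open>C\<alpha>\<^sup>n < 1\<close>, and (b) results from
  absorbing it. Absorption needs \<open>T \<mu> \<mu>\<epsilon> < \<infinity>\<close>, which holds because an invariant measure integrates
  every Lyapunov function of its kernel (\<open>nn_integral_lyapunov_invariant_le\<close>) and
  \<open>tilde_dist d V \<beta> x y \<le> 2 + \<beta> V x + \<beta> V y\<close>. For (c) the distance between the two \<open>n\<close>-step kernels is
  bounded by induction on \<open>n\<close>: the last step contracts the error made so far and adds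
  \<open>\<epsilon> (1 + \<delta> (P\<epsilon>\<^sup>n V)(x))\<close>, where \<open>P\<epsilon>\<^sup>n V \<le> V + K\<epsilon> / (1 - \<gamma>\<epsilon>)\<close>. The right-hand side of this last
  inequality is therefore the Lyapunov function to take.

  Convexity under mixtures and the triangle inequality both follow from one compactness principle
  (\<open>ex_limit_coupling\<close>). If the marginals of a net of probability measures on a product of Polish spaces converge
  on every Borel set, Tychonoff's theorem provides a subnet along which the measures of all sets converge. The
  limit is only finitely additive. But its marginals are measures and hence tight, so that the limit is approximated
  from inside by compact sets on all finite unions of rectangles, and by a theorem of Alexandroff
  (\<open>ex_measure_extending\<close>) it agrees there with a measure: a coupling of the limiting marginals. The integral of
  a lower semicontinuous cost does not increase in this limit. For mixtures the net consists of mixtures in which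
  \<open>z\<close> is replaced by a discrete representative, so that the choice of a coupling takes countably many values
  and is measurable. For the gluing of two couplings the net consists of the couplings that are conditionally
  independent given a finite partition of the middle space.
\<close>

section \<open>Finitely additive set functions with compact approximation\<close>

text \<open>The approximation is required of a set and of its complement alike. This makes the family closed under complements
  by definition, so that only unions need an argument to see that it is an algebra.\<close>

definition compact_regular_sets :: "('a::topological_space set \<Rightarrow> real) \<Rightarrow> 'a set set" where
  "compact_regular_sets f = {R \<in> sets borel.
     (\<forall>e>0. \<exists>K\<subseteq>R. compact K \<and> f (R - K) \<le> e) \<and> (\<forall>e>0. \<exists>K\<subseteq>- R. compact K \<and> f (- R - K) \<le> e)}"

locale borel_charge =
  fixes f :: "'a::t2_space set \<Rightarrow> real"
  assumes nonneg: "A \<in> sets borel \<Longrightarrow> 0 \<le> f A"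
    and additive: "A \<in> sets borel \<Longrightarrow> B \<in> sets borel \<Longrightarrow> A \<inter> B = {} \<Longrightarrow> f (A \<union> B) = f A + f B"
begin

lemma empty: "f {} = 0"
  using additive[of "{}" "{}"] by simp

lemma mono: "A \<in> sets borel \<Longrightarrow> B \<in> sets borel \<Longrightarrow> A \<subseteq> B \<Longrightarrow> f A \<le> f B"
  using additive[of A "B - A"] nonneg[of "B - A"] by (simp add: Un_absorb1)

lemma subadditive: "A \<in> sets borel \<Longrightarrow> B \<in> sets borel \<Longrightarrow> f (A \<union> B) \<le> f A + f B"
  using additive[of A "B - A"] mono[of "B - A" B] by auto

lemma subadditive_finite:
  "finite I \<Longrightarrow> (\<And>i. i \<in> I \<Longrightarrow> A i \<in> sets borel) \<Longrightarrow> f (\<Union>i\<in>I. A i) \<le> (\<Sum>i\<in>I. f (A i))"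
proof (induction I rule: finite_induct)
  case (insert i I)
  have "f (A i \<union> (\<Union>i\<in>I. A i)) \<le> f (A i) + f (\<Union>i\<in>I. A i)"
    using insert by (intro subadditive sets.finite_UN) auto
  also have "f (\<Union>i\<in>I. A i) \<le> (\<Sum>i\<in>I. f (A i))"
    using insert by auto
  finally show ?case using insert by simp
qed (simp add: empty)

lemma compact_regular_sets_Compl: "R \<in> compact_regular_sets f \<Longrightarrow> - R \<in> compact_regular_sets f"
  by (auto simp: compact_regular_sets_def)

lemma compact_borel: "compact K \<Longrightarrow> K \<in> sets (borel :: 'a measure)"
  by (intro borel_closed compact_imp_closed)

lemma inner_approx_Un:
  assumes [measurable]: "R \<in> sets borel" "S \<in> sets borel"
    and R: "\<forall>e>0. \<exists>K\<subseteq>R. compact K \<and> f (R - K) \<le> e" and S: "\<forall>e>0. \<exists>K\<subseteq>S. compact K \<and> f (S - K) \<le> e"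
    and e: "0 < e"
  shows "\<exists>K\<subseteq>R \<union> S. compact K \<and> f (R \<union> S - K) \<le> e"
proof -
  obtain K L where K: "K \<subseteq> R" "compact K" "f (R - K) \<le> e / 2"
    and L: "L \<subseteq> S" "compact L" "f (S - L) \<le> e / 2"
    using R S e half_gt_zero by metis
  have [measurable]: "K \<in> sets borel" "L \<in> sets borel"
    using K L compact_borel by auto
  have "f (R \<union> S - (K \<union> L)) \<le> f ((R - K) \<union> (S - L))"
    by (intro mono) auto
  also have "\<dots> \<le> f (R - K) + f (S - L)"
    by (intro subadditive) auto
  also have "\<dots> \<le> e" using K L by simp
  finally show ?thesis using K L by (intro exI[of _ "K \<union> L"]) auto
qed

lemma inner_approx_Int:
  assumes [measurable]: "R \<in> sets borel" "S \<in> sets borel"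
    and R: "\<forall>e>0. \<exists>K\<subseteq>R. compact K \<and> f (R - K) \<le> e" and S: "\<forall>e>0. \<exists>K\<subseteq>S. compact K \<and> f (S - K) \<le> e"
    and e: "0 < e"
  shows "\<exists>K\<subseteq>R \<inter> S. compact K \<and> f (R \<inter> S - K) \<le> e"
proof -
  obtain K L where K: "K \<subseteq> R" "compact K" "f (R - K) \<le> e / 2"
    and L: "L \<subseteq> S" "compact L" "f (S - L) \<le> e / 2"
    using R S e half_gt_zero by metis
  have [measurable]: "K \<in> sets borel" "L \<in> sets borel"
    using K L compact_borel by auto
  have "f (R \<inter> S - (K \<inter> L)) \<le> f ((R - K) \<union> (S - L))"
    by (intro mono) auto
  also have "\<dots> \<le> f (R - K) + f (S - L)"
    by (intro subadditive) auto
  also have "\<dots> \<le> e" using K L by simp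
  finally show ?thesis using K L by (intro exI[of _ "K \<inter> L"]) (auto intro: compact_Int)
qed

lemma compact_regular_sets_Un:
  assumes "R \<in> compact_regular_sets f" "S \<in> compact_regular_sets f"
  shows "R \<union> S \<in> compact_regular_sets f"
  using assms inner_approx_Un[of R S] inner_approx_Int[of "- R" "- S"]
  unfolding compact_regular_sets_def by (auto simp: Compl_Un)

lemma algebra_compact_regular_sets:
  assumes "R \<in> compact_regular_sets f"
  shows "algebra UNIV (compact_regular_sets f)"
proof -
  have "R \<union> - R \<in> compact_regular_sets f"
    by (intro compact_regular_sets_Un compact_regular_sets_Compl assms)
  then have "- UNIV \<in> compact_regular_sets f"
    by (intro compact_regular_sets_Compl) simp
  then show ?thesis
    unfolding algebra_iff_Un
    by (auto simp: Compl_eq_Diff_UNIV[symmetric] intro: compact_regular_sets_Un compact_regular_sets_Compl)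
qed

text \<open>Alexandroff's argument: if \<open>K n\<close> exhausts \<open>A n\<close> up to \<open>e / 2^(n+1)\<close>, then the sets \<open>K n\<close> have empty intersection,
  so by compactness finitely many of them do. From then on \<open>A n\<close> is covered by the remainders \<open>A i - K i\<close>, whose
  total mass is at most \<open>e\<close>.\<close>

lemma continuous_at_empty:
  assumes A: "\<And>n. A n \<in> compact_regular_sets f" and dec: "decseq A" and empty: "(\<Inter>n. A n) = {}"
  shows "(\<lambda>n. f (A n)) \<longlonglongrightarrow> 0"
proof (rule LIMSEQ_I)
  fix r :: real assume "0 < r"
  define e where "e = r / 2"
  have e: "0 < e" "e < r" using \<open>0 < r\<close> by (auto simp: e_def)
  have A_borel[measurable]: "A n \<in> sets borel" for n using A by (auto simp: compact_regular_sets_def)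
  have "\<exists>K\<subseteq>A n. compact K \<and> f (A n - K) \<le> e * (1 / 2) ^ Suc n" for n
  proof -
    have "0 < e * (1 / 2) ^ Suc n" using e by simp
    then show ?thesis using A[of n] unfolding compact_regular_sets_def by blast
  qed
  then obtain K where K: "\<And>n. K n \<subseteq> A n" "\<And>n. compact (K n)"
      "\<And>n. f (A n - K n) \<le> e * (1 / 2) ^ Suc n"
    by metis
  have K_borel[measurable]: "K n \<in> sets borel" for n
    using K(2) compact_borel by auto
  have "\<exists>I. finite I \<and> K 0 \<inter> (\<Inter>n\<in>I. K n) = {}"
  proof (rule ccontr)
    assume "\<not> ?thesis"
    then have "K 0 \<inter> (\<Inter>n\<in>UNIV. K n) \<noteq> {}"
      using compact_imp_fip_image[of "K 0" UNIV K, OF K(2) compact_imp_closed[OF K(2)]] by simp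
    moreover have "(\<Inter>n. K n) \<subseteq> (\<Inter>n. A n)"
      by (rule INF_mono) (use K(1) in auto)
    ultimately show False using empty by simp
  qed
  then obtain I where I: "finite I" "K 0 \<inter> (\<Inter>n\<in>I. K n) = {}" by blast
  let ?J = "insert 0 I"
  have "norm (f (A n) - 0) < r" if n: "n \<ge> Max ?J" for n
  proof -
    have "A n \<subseteq> (\<Union>i\<in>?J. A i - K i)"
    proof
      fix x assume "x \<in> A n"
      moreover have "i \<le> n" if "i \<in> ?J" for i using n that I(1) by auto
      ultimately have "x \<in> A i" if "i \<in> ?J" for i
        using decseqD[OF dec, of i n] that by blast
      then show "x \<in> (\<Union>i\<in>?J. A i - K i)" using I(2) by auto
    qed
    then have "f (A n) \<le> f (\<Union>i\<in>?J. A i - K i)"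
      using I(1) by (intro mono sets.finite_UN) auto
    also have "\<dots> \<le> (\<Sum>i\<in>?J. f (A i - K i))"
      using I(1) by (intro subadditive_finite) auto
    also have "\<dots> \<le> (\<Sum>i\<in>?J. e * (1 / 2) ^ Suc i)"
      by (intro sum_mono K)
    also have "\<dots> = e * (\<Sum>i\<in>?J. (1 / 2) ^ Suc i)"
      by (simp add: sum_distrib_left)
    also have "(\<Sum>i\<in>?J. (1 / 2 :: real) ^ Suc i) \<le> (\<Sum>i. (1 / 2) ^ Suc i)"
      using I(1) power_half_series by (intro sum_le_suminf) (auto simp: sums_iff)
    also have "(\<Sum>i. (1 / 2 :: real) ^ Suc i) = 1" using power_half_series by (simp add: sums_iff)
    finally have "f (A n) \<le> e" using e by simp
    then show ?thesis using e nonneg[of "A n"] by simp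
  qed
  then show "\<exists>no. \<forall>n\<ge>no. norm (f (A n) - 0) < r" by blast
qed

text \<open>Continuity at the empty set is what Caratheodory's extension theorem asks of a finitely additive set function. The
  extension need not agree with \<open>f\<close> on Borel sets outside the algebra.\<close>

lemma ex_measure_extending:
  assumes G: "G \<subseteq> compact_regular_sets f" "G \<noteq> {}"
    and gen: "sets borel = sigma_sets UNIV G"
  shows "\<exists>M. sets M = sets borel \<and> (\<forall>R\<in>compact_regular_sets f. emeasure M R = ennreal (f R))"
proof -
  let ?M = "compact_regular_sets f"
  interpret algebra UNIV ?M
    using G algebra_compact_regular_sets by auto
  have M_borel: "?M \<subseteq> sets borel" by (auto simp: compact_regular_sets_def)
  have "\<exists>\<mu> :: 'a set \<Rightarrow> ennreal. (\<forall>s\<in>?M. \<mu> s = ennreal (f s)) \<and>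
      measure_space UNIV (sigma_sets UNIV ?M) \<mu>"
  proof (rule caratheodory_empty_continuous)
    show "positive ?M (\<lambda>s. ennreal (f s))" by (simp add: positive_def empty)
    show "Measure_Space.additive ?M (\<lambda>s. ennreal (f s))"
      using M_borel nonneg by (auto simp: Measure_Space.additive_def additive subset_iff)
    show "(\<lambda>i. ennreal (f (A i))) \<longlonglongrightarrow> 0"
      if "range A \<subseteq> ?M" "decseq A" "(\<Inter>i. A i) = {}" for A
      using tendsto_ennrealI[OF continuous_at_empty[of A]] that by auto
  qed auto
  then obtain \<mu> :: "'a set \<Rightarrow> ennreal"
    where \<mu>: "\<And>s. s \<in> ?M \<Longrightarrow> \<mu> s = ennreal (f s)" "measure_space UNIV (sigma_sets UNIV ?M) \<mu>"
    by blast
  have "sigma_sets UNIV ?M = sets borel"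
  proof
    show "sigma_sets UNIV ?M \<subseteq> sets borel"
      using sets.sigma_sets_subset[OF M_borel] by simp
    show "sets borel \<subseteq> sigma_sets UNIV ?M"
      unfolding gen by (intro sigma_sets_mono') (rule G)
  qed
  with \<mu> have "sets (measure_of UNIV (sets borel) \<mu>) = sets borel"
      "\<forall>R\<in>?M. emeasure (measure_of UNIV (sets borel) \<mu>) R = ennreal (f R)"
    using M_borel
    by (auto simp: measure_space_def sigma_algebra.sigma_sets_eq intro!: emeasure_measure_of_sigma[THEN trans])
  then show ?thesis by blast
qed

end

section \<open>Limits of couplings\<close>

text \<open>A cluster point of \<open>\<Phi>\<close> in the compact product \<open>[0,1]^b\<close> exists by Tychonoff's theorem. The filter \<open>G\<close> plays
  the role of the convergent subnet.\<close>

lemma ex_subfilter_pointwise_convergent: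
  fixes \<Phi> :: "'i \<Rightarrow> 'b \<Rightarrow> real"
  assumes F: "F \<noteq> bot" and \<Phi>: "\<And>i b. \<Phi> i b \<in> {0..1}"
  obtains G f where "G \<le> F" "G \<noteq> bot" "\<And>b. ((\<lambda>i. \<Phi> i b) \<longlongrightarrow> f b) G"
proof -
  let ?S = "PiE UNIV (\<lambda>_ :: 'b. {0..1 :: real})"
  have "compactin (product_topology (\<lambda>_. euclidean) UNIV) ?S"
    by (simp add: compactin_PiE)
  then have compact: "compact ?S"
    by (simp add: euclidean_product_topology)
  have "eventually (\<lambda>\<phi>. \<phi> \<in> ?S) (filtermap \<Phi> F)"
    using \<Phi> by (auto simp: eventually_filtermap intro!: always_eventually)
  moreover have "filtermap \<Phi> F \<noteq> bot" using F by (simp add: filtermap_bot_iff)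
  ultimately obtain f where f: "inf (nhds f) (filtermap \<Phi> F) \<noteq> bot"
    using compact[unfolded compact_filter, rule_format, of "filtermap \<Phi> F"] by auto
  define G where "G = inf F (filtercomap \<Phi> (nhds f))"
  have "G \<noteq> bot"
  proof
    assume "G = bot"
    then have "eventually (\<lambda>_. False) G" by simp
    then obtain P R where P: "eventually P F" and R: "eventually R (filtercomap \<Phi> (nhds f))"
      and PR: "\<And>i. P i \<Longrightarrow> R i \<Longrightarrow> False"
      unfolding G_def eventually_inf by auto
    from R obtain Q where Q: "eventually Q (nhds f)" "\<And>i. Q (\<Phi> i) \<Longrightarrow> R i"
      unfolding eventually_filtercomap by auto
    have "eventually (\<lambda>y. \<not> Q y) (filtermap \<Phi> F)"
      using P unfolding eventually_filtermap by eventually_elim (use PR Q(2) in auto)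
    with Q(1) have "eventually (\<lambda>_. False) (inf (nhds f) (filtermap \<Phi> F))"
      unfolding eventually_inf by (intro exI[of _ Q] exI[of _ "\<lambda>y. \<not> Q y"]) auto
    with f show False by (simp add: trivial_limit_def)
  qed
  moreover have "(\<Phi> \<longlongrightarrow> f) G"
    unfolding G_def by (rule filterlim_mono[OF filterlim_filtercomap order_refl inf_le2])
  then have "((\<lambda>i. \<Phi> i b) \<longlongrightarrow> f b) G" for b
    by (rule continuous_on_tendsto_compose[OF continuous_on_product_coordinates]) auto
  ultimately show ?thesis by (intro that[of G f]) (auto simp: G_def)
qed

lemma borel_Times:
  fixes A :: "'a::second_countable_topology set" and B :: "'b::second_countable_topology set"
  shows "A \<in> sets borel \<Longrightarrow> B \<in> sets borel \<Longrightarrow> A \<times> B \<in> sets borel"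
  by (metis borel_prod pair_measureI)

text \<open>Finite unions of these sets are the ones on which limits of couplings are controlled.\<close>

definition borel_rectangles ::
    "('a::topological_space \<times> 'b::topological_space) set set" where
  "borel_rectangles = {A \<times> B | A B. A \<in> sets borel \<and> B \<in> sets borel}"

lemma borel_rectanglesI: "A \<in> sets borel \<Longrightarrow> B \<in> sets borel \<Longrightarrow> A \<times> B \<in> borel_rectangles"
  by (auto simp: borel_rectangles_def)

lemma borel_rectangles_borel:
  fixes R :: "('a::second_countable_topology \<times> 'b::second_countable_topology) set"
  shows "R \<in> borel_rectangles \<Longrightarrow> R \<in> sets borel"
  by (auto simp: borel_rectangles_def borel_Times)

lemma Union_borel_rectangles_borel:
  fixes \<R> :: "('a::second_countable_topology \<times> 'b::second_countable_topology) set set"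
  shows "finite \<R> \<Longrightarrow> \<R> \<subseteq> borel_rectangles \<Longrightarrow> \<Union>\<R> \<in> sets borel"
  by (rule sets.finite_Union) (auto intro: borel_rectangles_borel)

lemma sets_borel_prod_generated:
  "sets (borel :: ('a::second_countable_topology \<times> 'b::second_countable_topology) measure) =
     sigma_sets UNIV borel_rectangles"
  unfolding borel_prod[symmetric] sets_pair_measure borel_rectangles_def by simp

lemma couplingsI:
  fixes \<Gamma> :: "('a::second_countable_topology \<times> 'b::second_countable_topology) measure"
  assumes \<mu>: "\<mu> \<in> space (prob_algebra borel)" and \<nu>: "\<nu> \<in> space (prob_algebra borel)"
    and \<Gamma>: "sets \<Gamma> = sets borel"
    and fst: "\<And>A. A \<in> sets borel \<Longrightarrow> emeasure \<Gamma> (A \<times> UNIV) = emeasure \<mu> A"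
    and snd: "\<And>B. B \<in> sets borel \<Longrightarrow> emeasure \<Gamma> (UNIV \<times> B) = emeasure \<nu> B"
  shows "\<Gamma> \<in> couplings \<mu> \<nu>"
proof -
  have sets: "sets \<mu> = sets borel" "sets \<nu> = sets borel" and "prob_space \<mu>"
    using \<mu> \<nu> by (auto simp: space_prob_algebra)
  have space: "space \<Gamma> = UNIV" "space \<mu> = UNIV"
    using sets_eq_imp_space_eq[OF \<Gamma>] sets_eq_imp_space_eq[OF sets(1)] by auto
  note [measurable_cong] = sets \<Gamma>
  have "prob_space \<Gamma>"
    using fst[of UNIV] space prob_space.emeasure_space_1[OF \<open>prob_space \<mu>\<close>]
    by (intro prob_spaceI) simp
  moreover have "sets \<Gamma> = sets (\<mu> \<Otimes>\<^sub>M \<nu>)"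
    using \<Gamma> sets_pair_measure_cong[OF sets, unfolded borel_prod] by simp
  moreover have fst': "fst \<in> \<Gamma> \<rightarrow>\<^sub>M borel" and snd': "snd \<in> \<Gamma> \<rightarrow>\<^sub>M borel"
    unfolding measurable_cong_sets[OF \<Gamma> refl] by (auto simp: borel_prod[symmetric])
  moreover have "distr \<Gamma> \<mu> fst = \<mu>"
  proof (rule measure_eqI)
    fix A assume "A \<in> sets (distr \<Gamma> \<mu> fst)"
    then have "A \<in> sets borel" using sets by simp
    moreover have "fst -` A \<inter> space \<Gamma> = A \<times> UNIV" using space by auto
    ultimately show "emeasure (distr \<Gamma> \<mu> fst) A = emeasure \<mu> A"
      using fst fst' sets measurable_cong_sets[OF refl sets(1), of \<Gamma>] by (subst emeasure_distr) auto
  qed simp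
  moreover have "distr \<Gamma> \<nu> snd = \<nu>"
  proof (rule measure_eqI)
    fix A assume "A \<in> sets (distr \<Gamma> \<nu> snd)"
    then have "A \<in> sets borel" using sets by simp
    moreover have "snd -` A \<inter> space \<Gamma> = UNIV \<times> A" using space by auto
    ultimately show "emeasure (distr \<Gamma> \<nu> snd) A = emeasure \<nu> A"
      using snd snd' sets measurable_cong_sets[OF refl sets(2), of \<Gamma>] by (subst emeasure_distr) auto
  qed simp
  ultimately show ?thesis by (auto simp: couplings_def)
qed

lemma couplingsD:
  fixes \<Gamma> :: "('a::second_countable_topology \<times> 'b::second_countable_topology) measure"
  assumes \<Gamma>: "\<Gamma> \<in> couplings \<mu> \<nu>" and sets: "sets \<mu> = sets borel" "sets \<nu> = sets borel"
  shows "\<Gamma> \<in> space (prob_algebra borel)"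
    and "distr \<Gamma> borel fst = \<mu>" and "distr \<Gamma> borel snd = \<nu>"
    and "A \<in> sets borel \<Longrightarrow> emeasure \<Gamma> (A \<times> UNIV) = emeasure \<mu> A"
    and "B \<in> sets borel \<Longrightarrow> emeasure \<Gamma> (UNIV \<times> B) = emeasure \<nu> B"
proof -
  have \<Gamma>': "sets \<Gamma> = sets borel"
    using \<Gamma> sets_pair_measure_cong[OF sets, unfolded borel_prod] by (auto simp: couplings_def)
  then show "\<Gamma> \<in> space (prob_algebra borel)"
    using \<Gamma> by (auto simp: space_prob_algebra couplings_def)
  have [simp]: "space \<Gamma> = UNIV" using sets_eq_imp_space_eq[OF \<Gamma>'] by simp
  have meas: "fst \<in> \<Gamma> \<rightarrow>\<^sub>M borel" "snd \<in> \<Gamma> \<rightarrow>\<^sub>M borel"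
    unfolding measurable_cong_sets[OF \<Gamma>' refl] by (auto simp: borel_prod[symmetric])
  show *: "distr \<Gamma> borel fst = \<mu>" "distr \<Gamma> borel snd = \<nu>"
    using \<Gamma> sets distr_cong[of \<Gamma> \<Gamma> borel \<mu> fst fst] distr_cong[of \<Gamma> \<Gamma> borel \<nu> snd snd]
    by (auto simp: couplings_def)
  show "emeasure \<Gamma> (A \<times> UNIV) = emeasure \<mu> A" if "A \<in> sets borel"
  proof -
    have "fst -` A = A \<times> (UNIV :: 'b set)" by auto
    then show ?thesis using emeasure_distr[OF meas(1) that] * by simp
  qed
  show "emeasure \<Gamma> (UNIV \<times> B) = emeasure \<nu> B" if "B \<in> sets borel"
  proof -
    have "snd -` B = (UNIV :: 'a set) \<times> B" by auto
    then show ?thesis using emeasure_distr[OF meas(2) that] * by simp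
  qed
qed

lemma measure_eqI_borel_rectangles:
  fixes M N :: "('a::second_countable_topology \<times> 'b::second_countable_topology) measure"
  assumes M: "M \<in> space (prob_algebra borel)" and N: "N \<in> space (prob_algebra borel)"
    and eq: "\<And>A B. A \<in> sets borel \<Longrightarrow> B \<in> sets borel \<Longrightarrow> emeasure M (A \<times> B) = emeasure N (A \<times> B)"
  shows "M = N"
proof (rule measure_eqI_generator_eq[where E = borel_rectangles and \<Omega> = UNIV and A = "\<lambda>_. UNIV"])
  interpret M: prob_space M using M by (simp add: space_prob_algebra)
  show "Int_stable (borel_rectangles :: ('a \<times> 'b) set set)"
  proof (rule Int_stableI)
    fix R S :: "('a \<times> 'b) set" assume "R \<in> borel_rectangles" "S \<in> borel_rectangles"
    then obtain A B A' B' where "R = A \<times> B" "S = A' \<times> B'"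
      and [measurable]: "A \<in> sets borel" "B \<in> sets borel" "A' \<in> sets borel" "B' \<in> sets borel"
      unfolding borel_rectangles_def by auto
    then have "R \<inter> S = (A \<inter> A') \<times> (B \<inter> B')" by auto
    then show "R \<inter> S \<in> borel_rectangles" by (simp add: borel_rectanglesI)
  qed
  show "emeasure M X = emeasure N X" if "X \<in> borel_rectangles" for X
    using that eq by (auto simp: borel_rectangles_def)
  show "sets M = sigma_sets UNIV borel_rectangles" "sets N = sigma_sets UNIV borel_rectangles"
    using M N sets_borel_prod_generated by (auto simp: space_prob_algebra)
  show "range (\<lambda>_. UNIV) \<subseteq> (borel_rectangles :: ('a \<times> 'b) set set)"
    using borel_rectanglesI[of UNIV UNIV] by auto
  show "emeasure M UNIV \<noteq> \<infinity>" for i :: nat using M.emeasure_finite[of UNIV] by simp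
qed auto

lemma tight_on_borel_set:
  fixes \<mu> :: "'a::polish_space measure"
  assumes \<mu>: "\<mu> \<in> space (prob_algebra borel)" and A: "A \<in> sets borel" and e: "0 < e"
  shows "\<exists>K\<subseteq>A. compact K \<and> measure \<mu> (A - K) \<le> e"
proof -
  interpret prob_space \<mu> using \<mu> by (simp add: space_prob_algebra)
  have sets: "sets \<mu> = sets borel" using \<mu> by (simp add: space_prob_algebra)
  have SUP: "emeasure \<mu> A = (SUP K \<in> {K. K \<subseteq> A \<and> compact K}. emeasure \<mu> K)"
    using sets A by (intro inner_regular) auto
  have "\<exists>K\<in>{K. K \<subseteq> A \<and> compact K}. emeasure \<mu> A < emeasure \<mu> K + ennreal e"
    by (rule SUP_approx_ennreal[OF e _ SUP]) auto
  then obtain K where K: "K \<subseteq> A" "compact K" "emeasure \<mu> A < emeasure \<mu> K + ennreal e"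
    by auto
  have "K \<in> sets \<mu>" using K(2) sets by (simp add: borel_closed compact_imp_closed)
  then have "measure \<mu> (A - K) = measure \<mu> A - measure \<mu> K"
    using K A sets by (intro finite_measure_Diff) auto
  moreover have "measure \<mu> A < measure \<mu> K + e"
    using K(3) e by (simp add: emeasure_eq_measure ennreal_less_iff flip: ennreal_plus)
  ultimately show ?thesis using K by (intro exI[of _ K]) auto
qed

text \<open>Tightness of the two marginals makes every measurable rectangle regular for the limiting set function: what a product of
  compact sets misses of \<open>A \<times> B\<close> is covered by two strips whose masses are read off from the marginals.\<close>

proposition ex_limit_coupling:
  fixes \<Gamma> :: "'i \<Rightarrow> ('a::polish_space \<times> 'b::polish_space) measure"
  assumes F: "F \<noteq> bot" and \<Gamma>: "\<And>i. \<Gamma> i \<in> space (prob_algebra borel)"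
    and \<mu>: "\<mu> \<in> space (prob_algebra borel)" and \<nu>: "\<nu> \<in> space (prob_algebra borel)"
    and fst: "\<And>A. A \<in> sets borel \<Longrightarrow> ((\<lambda>i. measure (\<Gamma> i) (A \<times> UNIV)) \<longlongrightarrow> measure \<mu> A) F"
    and snd: "\<And>B. B \<in> sets borel \<Longrightarrow> ((\<lambda>i. measure (\<Gamma> i) (UNIV \<times> B)) \<longlongrightarrow> measure \<nu> B) F"
  obtains G \<Lambda> where "G \<le> F" "G \<noteq> bot" "\<Lambda> \<in> couplings \<mu> \<nu>"
    "\<And>\<R>. finite \<R> \<Longrightarrow> \<R> \<subseteq> borel_rectangles \<Longrightarrow>
       ((\<lambda>i. measure (\<Gamma> i) (\<Union>\<R>)) \<longlongrightarrow> measure \<Lambda> (\<Union>\<R>)) G"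
proof -
  have \<Gamma>_sets: "sets (\<Gamma> i) = sets borel" and \<Gamma>_prob: "prob_space (\<Gamma> i)" for i
    using \<Gamma>[of i] by (auto simp: space_prob_algebra)
  obtain G f where G: "G \<le> F" "G \<noteq> bot" and f: "\<And>R. ((\<lambda>i. measure (\<Gamma> i) R) \<longlongrightarrow> f R) G"
  proof (rule ex_subfilter_pointwise_convergent[OF F, of "\<lambda>i. measure (\<Gamma> i)"])
    show "measure (\<Gamma> i) R \<in> {0..1}" for i R
      using prob_space.prob_le_1[OF \<Gamma>_prob] by simp
  qed (rule that)
  interpret borel_charge f
  proof
    show "0 \<le> f A" for A
      using tendsto_lowerbound[OF f _ G(2)] by simp
    show "f (A \<union> B) = f A + f B" if "A \<in> sets borel" "B \<in> sets borel" "A \<inter> B = {}" for A B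
    proof (rule tendsto_unique[OF G(2) f])
      have "measure (\<Gamma> i) (A \<union> B) = measure (\<Gamma> i) A + measure (\<Gamma> i) B" for i
        using that \<Gamma>_prob[of i] \<Gamma>_sets[of i]
        by (intro finite_measure.finite_measure_Union) (auto simp: prob_space_def)
      then show "((\<lambda>i. measure (\<Gamma> i) (A \<union> B)) \<longlongrightarrow> f A + f B) G"
        by (simp add: tendsto_add f)
    qed
  qed
  have f_fst: "f (A \<times> UNIV) = measure \<mu> A" if "A \<in> sets borel" for A
    using tendsto_unique[OF G(2) f tendsto_mono[OF G(1) fst[OF that]]] .
  have f_snd: "f (UNIV \<times> B) = measure \<nu> B" if "B \<in> sets borel" for B
    using tendsto_unique[OF G(2) f tendsto_mono[OF G(1) snd[OF that]]] .
  have approx: "\<exists>K\<subseteq>A \<times> B. compact K \<and> f (A \<times> B - K) \<le> e"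
    if AB[measurable]: "A \<in> sets borel" "B \<in> sets borel" and "0 < e" for A B e
  proof -
    obtain K L where K: "K \<subseteq> A" "compact K" "measure \<mu> (A - K) \<le> e / 2"
      and L: "L \<subseteq> B" "compact L" "measure \<nu> (B - L) \<le> e / 2"
      using tight_on_borel_set[OF \<mu> AB(1), of "e / 2"] tight_on_borel_set[OF \<nu> AB(2), of "e / 2"] \<open>0 < e\<close>
      by auto
    have [measurable]: "K \<in> sets borel" "L \<in> sets borel"
      using K L by (auto intro: borel_closed compact_imp_closed)
    have "f (A \<times> B - K \<times> L) \<le> f ((A - K) \<times> UNIV \<union> UNIV \<times> (B - L))"
      by (intro mono sets.Diff sets.Un borel_Times) auto
    also have "\<dots> \<le> f ((A - K) \<times> UNIV) + f (UNIV \<times> (B - L))"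
      by (intro subadditive borel_Times) auto
    also have "\<dots> \<le> e" using K L by (simp add: f_fst f_snd)
    finally show ?thesis
      using K L by (intro exI[of _ "K \<times> L"]) (auto intro: compact_Times)
  qed
  have rect: "A \<times> B \<in> compact_regular_sets f"
    if [measurable]: "A \<in> sets borel" "B \<in> sets borel" for A B
  proof -
    have "- (A \<times> B) = (- A) \<times> UNIV \<union> UNIV \<times> (- B)" by auto
    moreover have "\<exists>K\<subseteq>(- A) \<times> UNIV \<union> UNIV \<times> (- B). compact K \<and>
        f ((- A) \<times> UNIV \<union> UNIV \<times> (- B) - K) \<le> e" if "0 < e" for e
    proof (rule inner_approx_Un[OF _ _ _ _ that])
      show "(- A) \<times> UNIV \<in> sets (borel :: ('a \<times> 'b) measure)"
        "UNIV \<times> (- B) \<in> sets (borel :: ('a \<times> 'b) measure)"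
        by (rule borel_Times; measurable)+
      show "\<forall>e>0. \<exists>K\<subseteq>(- A) \<times> UNIV. compact K \<and> f ((- A) \<times> UNIV - K) \<le> e"
        "\<forall>e>0. \<exists>K\<subseteq>UNIV \<times> (- B). compact K \<and> f (UNIV \<times> (- B) - K) \<le> e"
        by (intro allI impI approx; measurable)+
    qed
    moreover have "A \<times> B \<in> sets borel" by (rule borel_Times) measurable
    moreover have "\<exists>K\<subseteq>A \<times> B. compact K \<and> f (A \<times> B - K) \<le> e" if "0 < e" for e
      by (rule approx[OF _ _ that]) measurable
    ultimately show ?thesis
      unfolding compact_regular_sets_def mem_Collect_eq by presburger
  qed
  have G_sub: "borel_rectangles \<subseteq> compact_regular_sets f"
    using rect by (auto simp: borel_rectangles_def)
  have "borel_rectangles \<noteq> ({} :: ('a \<times> 'b) set set)"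
    using borel_rectanglesI[of UNIV UNIV] by auto
  then obtain \<Lambda> where \<Lambda>: "sets \<Lambda> = sets borel"
      "\<And>R. R \<in> compact_regular_sets f \<Longrightarrow> emeasure \<Lambda> R = ennreal (f R)"
    using ex_measure_extending[OF G_sub _ sets_borel_prod_generated] by blast
  interpret algebra UNIV "compact_regular_sets f"
    using algebra_compact_regular_sets rect[of UNIV UNIV] by auto
  interpret \<mu>: prob_space \<mu> using \<mu> by (simp add: space_prob_algebra)
  interpret \<nu>: prob_space \<nu> using \<nu> by (simp add: space_prob_algebra)
  have "\<Lambda> \<in> couplings \<mu> \<nu>"
    using \<mu> \<nu> \<Lambda>(1)
    by (rule couplingsI) (simp_all add: \<Lambda>(2) rect f_fst f_snd \<mu>.emeasure_eq_measure \<nu>.emeasure_eq_measure)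
  moreover have "((\<lambda>i. measure (\<Gamma> i) (\<Union>\<R>)) \<longlongrightarrow> measure \<Lambda> (\<Union>\<R>)) G" if "finite \<R>" "\<R> \<subseteq> borel_rectangles" for \<R>
  proof -
    have *: "\<Union>\<R> \<in> compact_regular_sets f"
      using that G_sub by (intro finite_Union) auto
    then have "measure \<Lambda> (\<Union>\<R>) = f (\<Union>\<R>)"
      using nonneg[of "\<Union>\<R>"] by (simp add: measure_def \<Lambda>(2) compact_regular_sets_def)
    then show ?thesis using f by simp
  qed
  ultimately show ?thesis by (rule that[OF G])
qed

section \<open>Integrals of lower semicontinuous costs\<close>

lemma lower_semicontinuous_iff_open: "lower_semicontinuous f \<longleftrightarrow> (\<forall>t. open {x. t < f x})"
  unfolding lower_semicontinuous_def
proof (intro iffI allI impI)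
  fix t assume *: "\<forall>x. \<forall>a<f x. \<forall>\<^sub>F y in nhds x. a < f y"
  show "open {x. t < f x}"
    using * by (subst open_subopen) (fastforce simp: eventually_nhds subset_iff)
next
  fix x a assume "\<forall>t. open {x. t < f x}" "a < f x"
  then show "\<forall>\<^sub>F y in nhds x. a < f y"
    by (auto simp: eventually_nhds)
qed

lemma lower_semicontinuous_borel:
  "lower_semicontinuous f \<Longrightarrow> f \<in> borel_measurable borel"
  unfolding lower_semicontinuous_iff_open by (intro borel_measurableI_greater) auto

text \<open>A step function with steps of height \<open>h\<close>, cut off at height \<open>N * h\<close>. It involves \<open>t\<close> only through the
  conditions \<open>k * h < t\<close>, which for a lower semicontinuous \<open>t = c p\<close> define open sets of \<open>p\<close>.\<close>

definition staircase :: "real \<Rightarrow> nat \<Rightarrow> real \<Rightarrow> real" where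
  "staircase h N t = (\<Sum>k\<in>{1..N}. h * of_bool (real k * h < t))"

lemma staircase_0 [simp]: "staircase h 0 t = 0"
  by (simp add: staircase_def)

lemma staircase_Suc:
  "staircase h (Suc N) t = staircase h N t + h * of_bool (real (Suc N) * h < t)"
  by (simp add: staircase_def)

lemma staircase_le_height: "0 < h \<Longrightarrow> staircase h N t \<le> real N * h"
  by (induction N) (auto simp: staircase_Suc algebra_simps)

lemma staircase_le: "0 < h \<Longrightarrow> 0 \<le> t \<Longrightarrow> staircase h N t \<le> t"
proof (induction N)
  case (Suc N)
  have "real (Suc N) * h = real N * h + h" by (simp add: algebra_simps)
  then show ?case
    using Suc staircase_le_height[of h N t] by (cases "real (Suc N) * h < t") (simp_all add: staircase_Suc)
qed simp

lemma staircase_eq_height: "0 < h \<Longrightarrow> real N * h < t \<Longrightarrow> staircase h N t = real N * h"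
proof (induction N)
  case (Suc N)
  have "real (Suc N) * h = real N * h + h" by (simp add: algebra_simps)
  then show ?case using Suc by (simp add: staircase_Suc)
qed simp

lemma staircase_ge: "0 < h \<Longrightarrow> 0 \<le> t \<Longrightarrow> t \<le> real N * h \<Longrightarrow> t - h \<le> staircase h N t"
proof (induction N)
  case (Suc N)
  have N: "real (Suc N) * h = real N * h + h" by (simp add: algebra_simps)
  show ?case
  proof (cases "t \<le> real N * h")
    case True
    then have "\<not> real (Suc N) * h < t" using N Suc.prems by simp
    then show ?thesis using Suc True by (simp add: staircase_Suc)
  next
    case False
    then show ?thesis
      using Suc.prems N staircase_eq_height[of h N t] by (simp add: staircase_Suc)
  qed
qed simp

lemma staircase_tendsto:
  assumes t: "0 \<le> t"
  shows "(\<lambda>n. staircase (1 / real (Suc n)) (Suc n * Suc n) t) \<longlonglongrightarrow> t"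
proof (rule tendsto_sandwich)
  show "eventually (\<lambda>n. t - 1 / real (Suc n) \<le> staircase (1 / real (Suc n)) (Suc n * Suc n) t) sequentially"
    using eventually_ge_at_top[of "nat \<lceil>t\<rceil>"]
  proof eventually_elim
    case (elim n)
    moreover have "real (Suc n * Suc n) * (1 / real (Suc n)) = real (Suc n)"
      by (simp only: of_nat_mult) simp
    ultimately have "t \<le> real (Suc n * Suc n) * (1 / real (Suc n))" by linarith
    then show ?case using t by (intro staircase_ge) auto
  qed
  show "eventually (\<lambda>n. staircase (1 / real (Suc n)) (Suc n * Suc n) t \<le> t) sequentially"
    using t by (intro always_eventually allI staircase_le) auto
  show "(\<lambda>n. t - 1 / real (Suc n)) \<longlonglongrightarrow> t"
    using tendsto_diff[OF tendsto_const LIMSEQ_Suc[OF lim_1_over_n], of t] by simp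
qed simp

text \<open>An open subset of the product is a countable union of open rectangles, hence is exhausted by finite unions.\<close>

lemma open_prod_approx:
  fixes \<Lambda> :: "('a::polish_space \<times> 'b::polish_space) measure"
  assumes \<Lambda>: "\<Lambda> \<in> space (prob_algebra borel)" and U: "open U" and e: "0 < e"
  obtains \<R> where "finite \<R>" "\<R> \<subseteq> borel_rectangles" "\<Union>\<R> \<subseteq> U"
    "measure \<Lambda> U \<le> measure \<Lambda> (\<Union>\<R>) + e"
proof -
  interpret prob_space \<Lambda> using \<Lambda> by (simp add: space_prob_algebra)
  have sets: "sets \<Lambda> = sets borel" using \<Lambda> by (simp add: space_prob_algebra)
  obtain \<A> :: "'a set set" where \<A>: "countable \<A>" "topological_basis \<A>" using ex_countable_basis by blast
  obtain \<B> :: "'b set set" where \<B>: "countable \<B>" "topological_basis \<B>" using ex_countable_basis by blast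
  define \<P> where "\<P> = insert {} {R \<in> (\<lambda>(A, B). A \<times> B) ` (\<A> \<times> \<B>). R \<subseteq> U}"
  have "countable \<P>" using \<A> \<B> by (simp add: \<P>_def)
  have "{} \<times> {} \<in> (borel_rectangles :: ('a \<times> 'b) set set)"
    by (rule borel_rectanglesI) auto
  moreover have "A \<times> B \<in> borel_rectangles" if "A \<in> \<A>" "B \<in> \<B>" for A B
    using topological_basis_open[OF \<A>(2) that(1)] topological_basis_open[OF \<B>(2) that(2)]
    by (intro borel_rectanglesI borel_open)
  ultimately have \<P>_rect: "\<P> \<subseteq> borel_rectangles"
    unfolding \<P>_def by auto
  have "\<Union>\<P> = U"
  proof
    have "topological_basis ((\<lambda>(A, B). A \<times> B) ` (\<A> \<times> \<B>))"
      using \<A> \<B> by (intro topological_basis_prod)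
    then obtain \<Q> where "\<Q> \<subseteq> (\<lambda>(A, B). A \<times> B) ` (\<A> \<times> \<B>)" "\<Union>\<Q> = U"
      using U unfolding topological_basis_def by blast
    then show "U \<subseteq> \<Union>\<P>" unfolding \<P>_def by blast
  qed (auto simp: \<P>_def)
  define R where "R = from_nat_into \<P>"
  have R: "range R = \<P>" using \<open>countable \<P>\<close> unfolding R_def by (intro range_from_nat_into) (auto simp: \<P>_def)
  have R_sets: "R n \<in> sets \<Lambda>" for n
    using \<P>_rect R rangeI[of R n] sets borel_rectangles_borel by (metis subsetD)
  have "(\<lambda>n. measure \<Lambda> (\<Union>i<n. R i)) \<longlonglongrightarrow> measure \<Lambda> (\<Union>n. \<Union>i<n. R i)"
    using R_sets by (intro finite_Lim_measure_incseq) (auto simp: incseq_def, force)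
  also have "(\<Union>n. \<Union>i<n. R i) = U"
    using R \<open>\<Union>\<P> = U\<close> by blast
  finally have "(\<lambda>n. measure \<Lambda> (\<Union>i<n. R i)) \<longlonglongrightarrow> measure \<Lambda> U" .
  then have "eventually (\<lambda>n. measure \<Lambda> U - e < measure \<Lambda> (\<Union>i<n. R i)) sequentially"
    using e by (intro order_tendstoD(1)) auto
  then obtain n where "measure \<Lambda> U - e < measure \<Lambda> (\<Union>i<n. R i)"
    by (auto simp: eventually_sequentially)
  moreover have "R ` {..<n} \<subseteq> \<P>" using R by blast
  ultimately show ?thesis
    using \<P>_rect \<open>\<Union>\<P> = U\<close> by (intro that[of "R ` {..<n}"]) (auto simp: subset_iff)
qed

text \<open>The lower half of the portmanteau theorem. The staircase of \<open>c\<close> is a positive combination of indicators of open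
  sets, each of which contains a finite union of rectangles of nearly full \<open>\<Lambda>\<close>-measure. On these unions the
  measures converge, and on each \<open>\<Gamma> i\<close> the combination stays below the integral of \<open>c\<close>.\<close>

proposition nn_integral_lsc_le_of_limit:
  fixes \<Gamma> :: "'i \<Rightarrow> ('a::polish_space \<times> 'b::polish_space) measure" and b :: ennreal
  assumes G: "G \<noteq> bot" and \<Gamma>: "\<And>i. \<Gamma> i \<in> space (prob_algebra borel)"
    and \<Lambda>: "\<Lambda> \<in> space (prob_algebra borel)"
    and lim: "\<And>\<R>. finite \<R> \<Longrightarrow> \<R> \<subseteq> borel_rectangles \<Longrightarrow>
       ((\<lambda>i. measure (\<Gamma> i) (\<Union>\<R>)) \<longlongrightarrow> measure \<Lambda> (\<Union>\<R>)) G"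
    and c: "lower_semicontinuous c" "\<And>p. 0 \<le> c p"
    and b: "eventually (\<lambda>i. (\<integral>\<^sup>+p. ennreal (c p) \<partial>\<Gamma> i) \<le> b) G"
  shows "(\<integral>\<^sup>+p. ennreal (c p) \<partial>\<Lambda>) \<le> b"
proof (cases "b = \<infinity>")
  case False
  interpret \<Lambda>: prob_space \<Lambda> using \<Lambda> by (simp add: space_prob_algebra)
  have sets_\<Lambda>[measurable_cong]: "sets \<Lambda> = sets borel" using \<Lambda> by (simp add: space_prob_algebra)
  have [measurable]: "c \<in> borel_measurable borel" using c(1) by (rule lower_semicontinuous_borel)
  have c_open: "open {p. t < c p}" for t using c(1) by (simp add: lower_semicontinuous_iff_open)
  have stairs: "(\<integral>\<^sup>+p. ennreal (staircase h N (c p)) \<partial>\<Lambda>) \<le> b" if h: "0 < h" for h N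
  proof -
    have "(\<Sum>k\<in>{1..N}. h * measure \<Lambda> {p. real k * h < c p}) \<le> enn2real b + e" if e: "0 < e" for e
    proof -
      \<comment> \<open>The error \<open>e'\<close> enters \<open>N\<close> times with weight \<open>h\<close>; adding 1 avoids division by zero for \<open>N = 0\<close>.\<close>
      define e' where "e' = e / (real N * h + 1)"
      have e': "0 < e'" "real N * h * e' \<le> e"
        using e h by (auto simp: e'_def field_simps add_pos_nonneg)
      have "\<exists>\<R>. finite \<R> \<and> \<R> \<subseteq> borel_rectangles \<and> \<Union>\<R> \<subseteq> {p. real k * h < c p} \<and>
          measure \<Lambda> {p. real k * h < c p} \<le> measure \<Lambda> (\<Union>\<R>) + e'" for k
        by (rule open_prod_approx[OF \<Lambda> c_open[of "real k * h"] e'(1)]) blast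
      then have "\<forall>k. \<exists>\<R>. finite \<R> \<and> \<R> \<subseteq> borel_rectangles \<and> \<Union>\<R> \<subseteq> {p. real k * h < c p} \<and>
          measure \<Lambda> {p. real k * h < c p} \<le> measure \<Lambda> (\<Union>\<R>) + e'" by (rule allI)
      from choice[OF this] obtain \<R> where \<R>: "\<forall>k. finite (\<R> k) \<and> \<R> k \<subseteq> borel_rectangles \<and>
          \<Union>(\<R> k) \<subseteq> {p. real k * h < c p} \<and>
          measure \<Lambda> {p. real k * h < c p} \<le> measure \<Lambda> (\<Union>(\<R> k)) + e'" ..
      note \<R> = \<R>[THEN spec, THEN conjunct1] \<R>[THEN spec, THEN conjunct2, THEN conjunct1]
        \<R>[THEN spec, THEN conjunct2, THEN conjunct2, THEN conjunct1]
        \<R>[THEN spec, THEN conjunct2, THEN conjunct2, THEN conjunct2]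
      have \<R>_borel[measurable]: "\<Union>(\<R> k) \<in> sets borel" for k
        using \<R>(1,2) by (rule Union_borel_rectangles_borel)
      have "(\<Sum>k\<in>{1..N}. h * measure \<Lambda> (\<Union>(\<R> k))) \<le> enn2real b"
      proof (rule tendsto_upperbound[OF _ _ G])
        show "((\<lambda>i. \<Sum>k\<in>{1..N}. h * measure (\<Gamma> i) (\<Union>(\<R> k))) \<longlongrightarrow> (\<Sum>k\<in>{1..N}. h * measure \<Lambda> (\<Union>(\<R> k)))) G"
          by (intro tendsto_sum tendsto_mult_left lim \<R>)
        show "\<forall>\<^sub>F i in G. (\<Sum>k\<in>{1..N}. h * measure (\<Gamma> i) (\<Union>(\<R> k))) \<le> enn2real b"
          using b
        proof eventually_elim
          case (elim i)
          interpret \<Gamma>: prob_space "\<Gamma> i" using \<Gamma> by (simp add: space_prob_algebra)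
          have [measurable_cong]: "sets (\<Gamma> i) = sets borel" using \<Gamma> by (simp add: space_prob_algebra)
          have "ennreal (\<Sum>k\<in>{1..N}. h * measure (\<Gamma> i) (\<Union>(\<R> k))) =
              (\<Sum>k\<in>{1..N}. ennreal h * emeasure (\<Gamma> i) (\<Union>(\<R> k)))"
            using h by (simp add: \<Gamma>.emeasure_eq_measure ennreal_mult sum_ennreal[symmetric] del: sum_ennreal)
          also have "\<dots> = (\<integral>\<^sup>+p. (\<Sum>k\<in>{1..N}. ennreal h * indicator (\<Union>(\<R> k)) p) \<partial>\<Gamma> i)"
            by (subst nn_integral_sum) (auto simp: nn_integral_cmult_indicator)
          also have "\<dots> \<le> (\<integral>\<^sup>+p. ennreal (c p) \<partial>\<Gamma> i)"
          proof (rule nn_integral_mono)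
            fix p
            have "(\<Sum>k\<in>{1..N}. ennreal h * indicator (\<Union>(\<R> k)) p) \<le> (\<Sum>k\<in>{1..N}. ennreal (h * of_bool (real k * h < c p)))"
              using \<R>(3) by (intro sum_mono) (auto simp: indicator_def)
            also have "\<dots> = ennreal (staircase h N (c p))"
              using h unfolding staircase_def by (intro sum_ennreal) auto
            also have "\<dots> \<le> ennreal (c p)"
              using h c(2) by (intro ennreal_leI staircase_le) auto
            finally show "(\<Sum>k\<in>{1..N}. ennreal h * indicator (\<Union>(\<R> k)) p) \<le> ennreal (c p)" .
          qed
          also have "\<dots> \<le> b" by (rule elim)
          finally have "ennreal (\<Sum>k\<in>{1..N}. h * measure (\<Gamma> i) (\<Union>(\<R> k))) \<le> ennreal (enn2real b)"
            using False by (simp add: less_top)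
          then show ?case by (subst (asm) ennreal_le_iff) auto
        qed
      qed
      moreover have "(\<Sum>k\<in>{1..N}. h * measure \<Lambda> {p. real k * h < c p}) \<le>
          (\<Sum>k\<in>{1..N}. h * (measure \<Lambda> (\<Union>(\<R> k)) + e'))"
        using h \<R>(4) by (intro sum_mono mult_left_mono) auto
      ultimately show ?thesis
        using e' by (simp add: distrib_left sum.distrib mult.assoc)
    qed
    then have *: "(\<Sum>k\<in>{1..N}. h * measure \<Lambda> {p. real k * h < c p}) \<le> enn2real b"
      by (rule field_le_epsilon)
    have "(\<integral>\<^sup>+p. ennreal (staircase h N (c p)) \<partial>\<Lambda>) =
        (\<integral>\<^sup>+p. (\<Sum>k\<in>{1..N}. ennreal h * indicator {p. real k * h < c p} p) \<partial>\<Lambda>)"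
    proof (rule nn_integral_cong)
      fix p
      have "ennreal (staircase h N (c p)) = (\<Sum>k\<in>{1..N}. ennreal (h * of_bool (real k * h < c p)))"
        using h unfolding staircase_def by (intro sum_ennreal[symmetric]) auto
      also have "\<dots> = (\<Sum>k\<in>{1..N}. ennreal h * indicator {p. real k * h < c p} p)"
        by (intro sum.cong) (auto simp: indicator_def)
      finally show "ennreal (staircase h N (c p)) = \<dots>" .
    qed
    also have "\<dots> = (\<Sum>k\<in>{1..N}. ennreal h * emeasure \<Lambda> {p. real k * h < c p})"
      by (subst nn_integral_sum) (auto simp: nn_integral_cmult_indicator)
    also have "\<dots> = ennreal (\<Sum>k\<in>{1..N}. h * measure \<Lambda> {p. real k * h < c p})"
      using h by (simp add: \<Lambda>.emeasure_eq_measure ennreal_mult sum_ennreal[symmetric] del: sum_ennreal)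
    also have "\<dots> \<le> ennreal (enn2real b)"
      by (rule ennreal_leI) (rule *)
    finally show ?thesis using False by (simp add: less_top)
  qed
  have "(\<integral>\<^sup>+p. ennreal (c p) \<partial>\<Lambda>) =
      (\<integral>\<^sup>+p. liminf (\<lambda>n. ennreal (staircase (1 / real (Suc n)) (Suc n * Suc n) (c p))) \<partial>\<Lambda>)"
    by (intro nn_integral_cong lim_imp_Liminf[symmetric] tendsto_ennrealI staircase_tendsto c) simp
  also have "\<dots> \<le> liminf (\<lambda>n. \<integral>\<^sup>+p. ennreal (staircase (1 / real (Suc n)) (Suc n * Suc n) (c p)) \<partial>\<Lambda>)"
    unfolding staircase_def by (intro nn_integral_liminf) measurable
  also have "\<dots> \<le> liminf (\<lambda>_ :: nat. b)"
    by (intro Liminf_mono always_eventually allI stairs) simp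
  also have "\<dots> = b" by (simp add: Liminf_const)
  finally show ?thesis .
qed simp

section \<open>Transport cost of mixtures\<close>

text \<open>The cost takes a pair as its argument, as lower semicontinuity and measurability refer to the product space.\<close>

definition transport_cost :: "('a \<times> 'b \<Rightarrow> real) \<Rightarrow> 'a measure \<Rightarrow> 'b measure \<Rightarrow> ennreal" where
  "transport_cost c \<mu> \<nu> = (INF \<Gamma>\<in>couplings \<mu> \<nu>. \<integral>\<^sup>+p. ennreal (c p) \<partial>\<Gamma>)"

lemma tilde_dist_measure_eq_transport_cost:
  "tilde_dist_measure d V \<beta> = transport_cost (\<lambda>(x, y). tilde_dist d V \<beta> x y)"
proof -
  have "(\<lambda>(x, y). ennreal (tilde_dist d V \<beta> x y)) = (\<lambda>p. ennreal (case p of (x, y) \<Rightarrow> tilde_dist d V \<beta> x y))"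
    by (auto simp: fun_eq_iff)
  then show ?thesis
    by (intro ext) (simp add: tilde_dist_measure_def transport_cost_def)
qed

lemma transport_cost_le: "\<Gamma> \<in> couplings \<mu> \<nu> \<Longrightarrow> transport_cost c \<mu> \<nu> \<le> (\<integral>\<^sup>+p. ennreal (c p) \<partial>\<Gamma>)"
  unfolding transport_cost_def by (rule INF_lower)

lemma ex_coupling_less:
  assumes "transport_cost c \<mu> \<nu> < a"
  obtains \<Gamma> where "\<Gamma> \<in> couplings \<mu> \<nu>" "(\<integral>\<^sup>+p. ennreal (c p) \<partial>\<Gamma>) < a"
  using assms unfolding transport_cost_def INF_less_iff by blast

lemma bind_in_prob_algebra:
  assumes "M \<in> space (prob_algebra N)" "K \<in> N \<rightarrow>\<^sub>M prob_algebra L"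
  shows "M \<bind> K \<in> space (prob_algebra L)"
  using prob_space_bind'[OF assms] sets_bind'[OF assms] by (simp add: space_prob_algebra)

text \<open>Points at which all functions in \<open>F\<close> have the same integer part share a representative. As there are only countably
  many such patterns, the map to the representatives is measurable for the discrete structure, and therefore so is
  its composition with an arbitrary function. A tolerance of 1 suffices, since \<open>F\<close> may contain multiples of a
  function.\<close>

lemma ex_discretization:
  fixes M :: "'z measure" and F :: "('z \<Rightarrow> real) set"
  assumes F: "finite F" "F \<subseteq> borel_measurable M"
  shows "\<exists>r \<in> M \<rightarrow>\<^sub>M count_space (space M). \<forall>z\<in>space M. \<forall>g\<in>F. \<bar>g (r z) - g z\<bar> \<le> 1"
proof -
  define code where "code z = restrict (\<lambda>g. \<lfloor>g z\<rfloor>) F" for z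
  define C where "C = PiE F (\<lambda>_ :: 'z \<Rightarrow> real. UNIV :: int set)"
  have "countable C" using F by (simp add: C_def countable_PiE)
  have code_mem: "code z \<in> C" for z by (auto simp: code_def C_def)
  have code: "code \<in> M \<rightarrow>\<^sub>M count_space C"
    unfolding measurable_count_space_eq_countable[OF \<open>countable C\<close>]
  proof (intro conjI ballI)
    fix c assume "c \<in> C"
    then have "code z = c \<longleftrightarrow> (\<forall>g\<in>F. \<lfloor>g z\<rfloor> = c g)" for z
      by (auto simp: code_def C_def PiE_iff extensional_def restrict_def fun_eq_iff)
    then have "code -` {c} \<inter> space M = {z \<in> space M. \<forall>g\<in>F. \<lfloor>g z\<rfloor> = c g}" by auto
    also have "\<dots> \<in> sets M"
    proof (intro sets.sets_Collect_finite_All F(1))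
      fix g assume "g \<in> F"
      then have [measurable]: "g \<in> borel_measurable M" using F by auto
      show "{z \<in> space M. \<lfloor>g z\<rfloor> = c g} \<in> sets M" by measurable
    qed
    finally show "code -` {c} \<inter> space M \<in> sets M" .
  qed (use code_mem in auto)
  define s where "s c = (SOME z. z \<in> space M \<and> code z = c)" for c
  have s: "s (code z) \<in> space M \<and> code (s (code z)) = code z" if "z \<in> space M" for z
    unfolding s_def by (rule someI[of _ z]) (use that in auto)
  have "(\<lambda>z. s (code z)) \<in> M \<rightarrow>\<^sub>M count_space UNIV"
    using code by (rule measurable_compose) simp
  then have "(\<lambda>z. s (code z)) \<in> M \<rightarrow>\<^sub>M count_space (space M)"
    using s by (auto simp: measurable_def)
  moreover have "\<bar>g (s (code z)) - g z\<bar> \<le> 1" if "z \<in> space M" "g \<in> F" for z g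
  proof -
    have "code (s (code z)) g = code z g" using s[OF that(1)] by simp
    then have "\<lfloor>g (s (code z))\<rfloor> = \<lfloor>g z\<rfloor>" using that(2) by (simp add: code_def)
    then show ?thesis by linarith
  qed
  ultimately show ?thesis by (intro bexI[of _ "\<lambda>z. s (code z)"] ballI)
qed

text \<open>Nearly optimal couplings \<open>\<gamma> z\<close> of \<open>K z\<close> and \<open>L z\<close> need not depend measurably on \<open>z\<close>. After \<open>z\<close> is replaced
  by its representative \<open>r F z\<close> they do, and their mixture is a measure. Along the net of finite sets \<open>F\<close> of
  measurable functions, its marginals converge on every Borel set to those of the mixtures of \<open>K\<close> and \<open>L\<close>.\<close>

proposition transport_cost_bind_le:
  fixes K :: "'z \<Rightarrow> 'a::polish_space measure" and L :: "'z \<Rightarrow> 'b::polish_space measure"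
    and f :: "'z \<Rightarrow> real"
  assumes M: "prob_space M"
    and K: "K \<in> M \<rightarrow>\<^sub>M prob_algebra borel" and L: "L \<in> M \<rightarrow>\<^sub>M prob_algebra borel"
    and c: "lower_semicontinuous c" "\<And>p. 0 \<le> c p"
    and f: "f \<in> borel_measurable M" "\<And>z. z \<in> space M \<Longrightarrow> 0 \<le> f z"
    and le: "\<And>z. z \<in> space M \<Longrightarrow> transport_cost c (K z) (L z) \<le> ennreal (f z)"
  shows "transport_cost c (M \<bind> K) (M \<bind> L) \<le> (\<integral>\<^sup>+z. ennreal (f z) \<partial>M)"
proof (rule ennreal_le_epsilon)
  fix e :: real assume "0 < e"
  define h where "h = e / 2"
  have h: "0 < h" "e = h + h" using \<open>0 < e\<close> by (auto simp: h_def)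
  interpret M: prob_space M by fact
  have M_alg: "M \<in> space (prob_algebra M)" using M by (simp add: space_prob_algebra)
  note [measurable] = f(1)
  have c_borel[measurable]: "c \<in> borel_measurable borel" using c(1) by (rule lower_semicontinuous_borel)
  have K_alg: "K z \<in> space (prob_algebra borel)" and L_alg: "L z \<in> space (prob_algebra borel)"
    if "z \<in> space M" for z
    using K L that by (auto dest: measurable_space)
  have "\<exists>\<gamma>. \<gamma> \<in> couplings (K z) (L z) \<and> (\<integral>\<^sup>+p. ennreal (c p) \<partial>\<gamma>) \<le> ennreal (f z + h)"
    if "z \<in> space M" for z
  proof -
    have "ennreal (f z) < ennreal (f z + h)"
      using h f(2)[OF that] by (simp add: ennreal_less_iff)
    with le[OF that] have "transport_cost c (K z) (L z) < ennreal (f z + h)" by (rule le_less_trans)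
    then show ?thesis by (rule ex_coupling_less) (auto intro: less_imp_le)
  qed
  then have "\<forall>z. \<exists>\<gamma>. z \<in> space M \<longrightarrow> \<gamma> \<in> couplings (K z) (L z) \<and> (\<integral>\<^sup>+p. ennreal (c p) \<partial>\<gamma>) \<le> ennreal (f z + h)"
    by blast
  from choice[OF this] obtain \<gamma>
    where \<gamma>: "\<And>z. z \<in> space M \<Longrightarrow> \<gamma> z \<in> couplings (K z) (L z)"
      "\<And>z. z \<in> space M \<Longrightarrow> (\<integral>\<^sup>+p. ennreal (c p) \<partial>\<gamma> z) \<le> ennreal (f z + h)"
    by blast
  have \<gamma>_sets: "\<gamma> z \<in> space (prob_algebra borel)"
      "A \<in> sets borel \<Longrightarrow> measure (\<gamma> z) (A \<times> UNIV) = measure (K z) A"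
      "B \<in> sets borel \<Longrightarrow> measure (\<gamma> z) (UNIV \<times> B) = measure (L z) B" if "z \<in> space M" for z A B
    using couplingsD[OF \<gamma>(1)[OF that]] K_alg[OF that] L_alg[OF that]
    by (auto simp: space_prob_algebra measure_def)
  have "\<exists>r. r \<in> M \<rightarrow>\<^sub>M count_space (space M) \<and> (finite F \<longrightarrow> F \<subseteq> borel_measurable M \<longrightarrow>
      (\<forall>z\<in>space M. \<forall>g\<in>F. \<bar>g (r z) - g z\<bar> \<le> 1))" for F :: "('z \<Rightarrow> real) set"
    using ex_discretization[of F M] ex_discretization[of "{}" M] by (cases "finite F \<and> F \<subseteq> borel_measurable M") auto
  then have "\<forall>F :: ('z \<Rightarrow> real) set. \<exists>r. r \<in> M \<rightarrow>\<^sub>M count_space (space M) \<and> (finite F \<longrightarrow> F \<subseteq> borel_measurable M \<longrightarrow>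
      (\<forall>z\<in>space M. \<forall>g\<in>F. \<bar>g (r z) - g z\<bar> \<le> 1))" by (rule allI)
  from choice[OF this] obtain r where
    r_all: "\<forall>F :: ('z \<Rightarrow> real) set. r F \<in> M \<rightarrow>\<^sub>M count_space (space M) \<and> (finite F \<longrightarrow> F \<subseteq> borel_measurable M \<longrightarrow>
      (\<forall>z\<in>space M. \<forall>g\<in>F. \<bar>g (r F z) - g z\<bar> \<le> 1))" ..
  note r = r_all[THEN spec, THEN conjunct1]
  have r_close: "\<bar>g (r F z) - g z\<bar> \<le> 1"
    if "finite F" "F \<subseteq> borel_measurable M" "z \<in> space M" "g \<in> F" for F z g
    using r_all[THEN spec, of F, THEN conjunct2] that by simp
  have r_space: "r F z \<in> space M" if "z \<in> space M" for F z
    using measurable_space[OF r that] by simp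
  have \<gamma>r: "(\<lambda>z. \<gamma> (r F z)) \<in> M \<rightarrow>\<^sub>M prob_algebra borel" for F
    by (rule measurable_compose[OF r]) (simp add: \<gamma>_sets)
  define \<F> where "\<F> = finite_subsets_at_top (borel_measurable M :: ('z \<Rightarrow> real) set)"
  have contains: "eventually (\<lambda>F. finite F \<and> F \<subseteq> borel_measurable M \<and> g \<in> F) \<F>"
    if "g \<in> borel_measurable M" for g
    unfolding \<F>_def eventually_finite_subsets_at_top using that by (intro exI[of _ "{g}"]) auto
  define \<Gamma> where "\<Gamma> F = M \<bind> (\<lambda>z. \<gamma> (r F z))" for F
  have measure_\<Gamma>: "measure (\<Gamma> F) R = (\<integral>z. measure (\<gamma> (r F z)) R \<partial>M)" if "R \<in> sets borel" for F R
    unfolding \<Gamma>_def by (rule M.measure_bind[OF measurable_prob_algebraD[OF \<gamma>r] that])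
  have marginal: "((\<lambda>F. \<integral>z. measure (\<kappa> (r F z)) A \<partial>M) \<longlongrightarrow> measure (M \<bind> \<kappa>) A) \<F>"
    if \<kappa>: "\<kappa> \<in> M \<rightarrow>\<^sub>M prob_algebra N" and A: "A \<in> sets N" for \<kappa> :: "'z \<Rightarrow> 'y measure" and N A
  proof (rule tendstoI)
    fix \<epsilon> :: real assume "0 < \<epsilon>"
    let ?k = "\<lambda>z. measure (\<kappa> z) A"
    have k[measurable]: "?k \<in> borel_measurable M"
      using measurable_compose[OF \<kappa> measurable_measure_prob_algebra[OF A]] .
    have k_r: "(\<lambda>z. ?k (r F z)) \<in> borel_measurable M" for F
      by (rule measurable_compose[OF r]) simp
    have le_1: "?k z \<le> 1" if "z \<in> space M" for z
      using measurable_space[OF \<kappa> that] by (auto simp: space_prob_algebra prob_space.prob_le_1)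
    have "(\<lambda>z. ?k z * (2 / \<epsilon>)) \<in> borel_measurable M" by measurable
    \<comment> \<open>Once the multiple by \<open>2 / \<epsilon>\<close> belongs to \<open>F\<close>, the tolerance 1 becomes \<open>\<epsilon> / 2\<close>.\<close>
    from contains[OF this] show "\<forall>\<^sub>F F in \<F>. dist (\<integral>z. ?k (r F z) \<partial>M) (measure (M \<bind> \<kappa>) A) < \<epsilon>"
    proof eventually_elim
      case (elim F)
      have close: "\<bar>?k (r F z) - ?k z\<bar> \<le> \<epsilon> / 2" if "z \<in> space M" for z
      proof -
        have "\<bar>?k (r F z) * (2 / \<epsilon>) - ?k z * (2 / \<epsilon>)\<bar> \<le> 1"
          using elim that r_close[of F z "\<lambda>z. ?k z * (2 / \<epsilon>)"] by blast
        then have "\<bar>?k (r F z) - ?k z\<bar> * (2 / \<epsilon>) \<le> 1"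
          using \<open>0 < \<epsilon>\<close> by (simp only: left_diff_distrib[symmetric] abs_mult abs_of_pos divide_pos_pos zero_less_numeral)
        then show ?thesis using \<open>0 < \<epsilon>\<close> by (simp add: field_simps)
      qed
      have int: "integrable M (\<lambda>z. ?k (r F z))" "integrable M ?k"
        using le_1 r_space k_r k by (auto intro!: M.integrable_const_bound[of _ 1])
      have "measure (M \<bind> \<kappa>) A = (\<integral>z. ?k z \<partial>M)"
        by (rule M.measure_bind[OF measurable_prob_algebraD[OF \<kappa>] A])
      then have "dist (\<integral>z. ?k (r F z) \<partial>M) (measure (M \<bind> \<kappa>) A) = \<bar>\<integral>z. ?k (r F z) - ?k z \<partial>M\<bar>"
        using int by (simp add: dist_real_def)
      also have "\<dots> \<le> (\<integral>z. \<bar>?k (r F z) - ?k z\<bar> \<partial>M)"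
        by (rule integral_abs_bound)
      also have "\<dots> \<le> (\<integral>z. \<epsilon> / 2 \<partial>M)"
        using int close by (intro integral_mono) auto
      also have "\<dots> = \<epsilon> / 2" by (simp add: M.prob_space)
      finally show ?case using \<open>0 < \<epsilon>\<close> by simp
    qed
  qed
  have fst: "((\<lambda>F. measure (\<Gamma> F) (A \<times> UNIV)) \<longlongrightarrow> measure (M \<bind> K) A) \<F>"
    if A: "A \<in> sets borel" for A
  proof -
    have "measure (\<Gamma> F) (A \<times> UNIV) = (\<integral>z. measure (K (r F z)) A \<partial>M)" for F
      using A r_space
      by (subst measure_\<Gamma>) (auto intro!: Bochner_Integration.integral_cong borel_Times simp: \<gamma>_sets)
    then show ?thesis using marginal[OF K A] by simp
  qed
  have snd: "((\<lambda>F. measure (\<Gamma> F) (UNIV \<times> B)) \<longlongrightarrow> measure (M \<bind> L) B) \<F>"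
    if B: "B \<in> sets borel" for B
  proof -
    have "measure (\<Gamma> F) (UNIV \<times> B) = (\<integral>z. measure (L (r F z)) B \<partial>M)" for F
      using B r_space
      by (subst measure_\<Gamma>) (auto intro!: Bochner_Integration.integral_cong borel_Times simp: \<gamma>_sets)
    then show ?thesis using marginal[OF L B] by simp
  qed
  have bind_alg: "\<Gamma> F \<in> space (prob_algebra borel)" "M \<bind> K \<in> space (prob_algebra borel)"
    "M \<bind> L \<in> space (prob_algebra borel)" for F
    unfolding \<Gamma>_def by (intro bind_in_prob_algebra[OF M_alg] K L \<gamma>r)+
  have bot: "\<F> \<noteq> bot" by (simp add: \<F>_def finite_subsets_at_top_neq_bot)
  obtain G \<Lambda> where G: "G \<le> \<F>" "G \<noteq> bot" and \<Lambda>: "\<Lambda> \<in> couplings (M \<bind> K) (M \<bind> L)"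
    and lim: "\<And>\<R>. finite \<R> \<Longrightarrow> \<R> \<subseteq> borel_rectangles \<Longrightarrow>
       ((\<lambda>F. measure (\<Gamma> F) (\<Union>\<R>)) \<longlongrightarrow> measure \<Lambda> (\<Union>\<R>)) G"
  proof (rule ex_limit_coupling[of \<F> \<Gamma> "M \<bind> K" "M \<bind> L"])
    fix G \<Lambda> assume "G \<le> \<F>" "G \<noteq> bot" "\<Lambda> \<in> couplings (M \<bind> K) (M \<bind> L)"
      "\<And>\<R>. finite \<R> \<Longrightarrow> \<R> \<subseteq> borel_rectangles \<Longrightarrow>
       ((\<lambda>F. measure (\<Gamma> F) (\<Union>\<R>)) \<longlongrightarrow> measure \<Lambda> (\<Union>\<R>)) G"
    then show thesis by (rule that)
  qed (rule bot bind_alg fst snd; assumption?)+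
  have "(\<lambda>z. f z / h) \<in> borel_measurable M" by measurable
  from contains[OF this]
  have "eventually (\<lambda>F. (\<integral>\<^sup>+p. ennreal (c p) \<partial>\<Gamma> F) \<le> (\<integral>\<^sup>+z. ennreal (f z) \<partial>M) + ennreal e) \<F>"
  proof eventually_elim
    case (elim F)
    have f_close: "f (r F z) \<le> f z + h" if "z \<in> space M" for z
    proof -
      have "\<bar>f (r F z) / h - f z / h\<bar> \<le> 1"
        using elim that r_close[of F z "\<lambda>z. f z / h"] by blast
      then have "f (r F z) / h \<le> f z / h + 1" by linarith
      then show ?thesis using h by (simp add: field_simps)
    qed
    have "(\<integral>\<^sup>+p. ennreal (c p) \<partial>\<Gamma> F) = (\<integral>\<^sup>+z. \<integral>\<^sup>+p. ennreal (c p) \<partial>\<gamma> (r F z) \<partial>M)"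
      unfolding \<Gamma>_def by (rule nn_integral_bind[OF _ measurable_prob_algebraD[OF \<gamma>r]]) measurable
    also have "\<dots> \<le> (\<integral>\<^sup>+z. ennreal (f z) + ennreal e \<partial>M)"
    proof (rule nn_integral_mono)
      fix z assume z: "z \<in> space M"
      have "(\<integral>\<^sup>+p. ennreal (c p) \<partial>\<gamma> (r F z)) \<le> ennreal (f (r F z) + h)"
        using \<gamma>(2) r_space z by blast
      also have "\<dots> \<le> ennreal (f z + e)"
        using f_close[OF z] h by (intro ennreal_leI) simp
      also have "\<dots> = ennreal (f z) + ennreal e"
        using f(2)[OF z] \<open>0 < e\<close> by simp
      finally show "(\<integral>\<^sup>+p. ennreal (c p) \<partial>\<gamma> (r F z)) \<le> ennreal (f z) + ennreal e" .
    qed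
    also have "\<dots> = (\<integral>\<^sup>+z. ennreal (f z) \<partial>M) + ennreal e"
      by (simp add: nn_integral_add M.emeasure_space_1)
    finally show ?case .
  qed
  then have "eventually (\<lambda>F. (\<integral>\<^sup>+p. ennreal (c p) \<partial>\<Gamma> F) \<le> (\<integral>\<^sup>+z. ennreal (f z) \<partial>M) + ennreal e) G"
    using G(1) by (rule filter_leD[rotated])
  moreover have "\<Lambda> \<in> space (prob_algebra borel)"
    using couplingsD(1)[OF \<Lambda>] bind_alg by (simp add: space_prob_algebra)
  ultimately have "(\<integral>\<^sup>+p. ennreal (c p) \<partial>\<Lambda>) \<le> (\<integral>\<^sup>+z. ennreal (f z) \<partial>M) + ennreal e"
    using nn_integral_lsc_le_of_limit[OF G(2) bind_alg(1) _ lim c] by blast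
  then show "transport_cost c (M \<bind> K) (M \<bind> L) \<le> (\<integral>\<^sup>+z. ennreal (f z) \<partial>M) + ennreal e"
    using transport_cost_le[OF \<Lambda>] by (rule order_trans[rotated])
qed

section \<open>Gluing of couplings and the weak triangle inequality\<close>

text \<open>Gluing treats one of the couplings as a marginal, so products of Polish spaces must be Polish.\<close>

instance prod :: (polish_space, polish_space) polish_space ..

lemma borel_measurable_prod_projections:
  "(\<lambda>((x, y), z). (y, z)) \<in> borel_measurable
     (borel :: (('a::second_countable_topology \<times> 'b::second_countable_topology) \<times> 'c::second_countable_topology) measure)"
  "(\<lambda>((x, y), z). (x, z)) \<in> borel_measurable
     (borel :: (('a::second_countable_topology \<times> 'b::second_countable_topology) \<times> 'c::second_countable_topology) measure)"
proof -
  have *: "(\<lambda>((x, y), z). (y, z)) = (\<lambda>w :: ('a \<times> 'b) \<times> 'c. (snd (fst w), snd w))"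
    "(\<lambda>((x, y), z). (x, z)) = (\<lambda>w :: ('a \<times> 'b) \<times> 'c. (fst (fst w), snd w))"
    by auto
  show "(\<lambda>((x, y), z). (y, z)) \<in> borel_measurable (borel :: (('a \<times> 'b) \<times> 'c) measure)"
    "(\<lambda>((x, y), z). (x, z)) \<in> borel_measurable (borel :: (('a \<times> 'b) \<times> 'c) measure)"
    unfolding * borel_prod[symmetric] by measurable
qed

context
  fixes \<mu> :: "'a::polish_space measure" and \<nu> :: "'b::polish_space measure" and \<rho> :: "'c::polish_space measure"
    and \<Gamma>\<^sub>1 :: "('a \<times> 'b) measure" and \<Gamma>\<^sub>2 :: "('b \<times> 'c) measure"
  assumes alg: "\<mu> \<in> space (prob_algebra borel)" "\<nu> \<in> space (prob_algebra borel)"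
      "\<rho> \<in> space (prob_algebra borel)"
    and \<Gamma>\<^sub>1: "\<Gamma>\<^sub>1 \<in> couplings \<mu> \<nu>" and \<Gamma>\<^sub>2: "\<Gamma>\<^sub>2 \<in> couplings \<nu> \<rho>"
begin

text \<open>For \<open>S \<subseteq> F\<close> these are the atoms of the finite algebra generated by \<open>F\<close>, some of them possibly empty.\<close>

definition block :: "'b set set \<Rightarrow> 'b set set \<Rightarrow> 'b set" where
  "block F S = {y. \<forall>B\<in>F. y \<in> B \<longleftrightarrow> B \<in> S}"

definition glue_density :: "'b set set \<Rightarrow> ('a \<times> 'b) \<times> ('b \<times> 'c) \<Rightarrow> ennreal" where
  "glue_density F = (\<lambda>(p, q). \<Sum>S\<in>Pow F. ennreal (1 / measure \<nu> (block F S)) *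
     (indicator (block F S) (snd p) * indicator (block F S) (fst q)))"

text \<open>Under this measure the last coordinate and the first two are conditionally independent given the block of the middle one.\<close>

definition glued :: "'b set set \<Rightarrow> (('a \<times> 'b) \<times> 'c) measure" where
  "glued F = distr (density (\<Gamma>\<^sub>1 \<Otimes>\<^sub>M \<Gamma>\<^sub>2) (glue_density F)) borel (\<lambda>(p, q). (p, snd q))"

lemma block_borel:
  assumes "finite F" "F \<subseteq> sets borel"
  shows "block F S \<in> sets borel"
proof -
  have "{y \<in> space borel. \<forall>B\<in>F. y \<in> B \<longleftrightarrow> B \<in> S} \<in> sets borel"
    by (intro sets.sets_Collect_finite_All assms(1)) (use assms(2) in auto)
  then show ?thesis by (simp add: block_def)
qed

lemma disjoint_blocks: "disjoint_family_on (block F) (Pow F)"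
  by (auto simp: disjoint_family_on_def block_def)

lemma ex_block: "\<exists>S\<in>Pow F. y \<in> block F S"
  by (rule bexI[of _ "{B \<in> F. y \<in> B}"]) (auto simp: block_def)

lemma sum_emeasure_blocks:
  assumes F: "finite F" "F \<subseteq> sets borel" and N: "sets N = sets borel" and A: "A \<in> sets borel"
    and g: "g \<in> borel_measurable borel"
  shows "(\<Sum>S\<in>Pow F. emeasure N (A \<inter> g -` block F S)) = emeasure N A"
proof -
  have "g -` block F S \<in> sets borel" for S
    using measurable_sets[OF g block_borel[OF F]] by simp
  then have "(\<Sum>S\<in>Pow F. emeasure N (A \<inter> g -` block F S)) = emeasure N (\<Union>S\<in>Pow F. A \<inter> g -` block F S)"
  proof (intro sum_emeasure)
    show "disjoint_family_on (\<lambda>S. A \<inter> g -` block F S) (Pow F)"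
      using disjoint_blocks[of F] unfolding disjoint_family_on_def by blast
  qed (use F A N in auto)
  also have "(\<Union>S\<in>Pow F. A \<inter> g -` block F S) = A"
  proof (intro equalityI subsetI)
    fix x assume "x \<in> A"
    obtain S where "S \<in> Pow F" "g x \<in> block F S" using ex_block[of F "g x"] by auto
    then show "x \<in> (\<Union>S\<in>Pow F. A \<inter> g -` block F S)" using \<open>x \<in> A\<close> by auto
  qed auto
  finally show ?thesis .
qed

lemma couplings_alg: "\<Gamma>\<^sub>1 \<in> space (prob_algebra borel)" "\<Gamma>\<^sub>2 \<in> space (prob_algebra borel)"
  using couplingsD(1)[OF \<Gamma>\<^sub>1] couplingsD(1)[OF \<Gamma>\<^sub>2] alg by (auto simp: space_prob_algebra)

lemma couplings_sets: "sets \<Gamma>\<^sub>1 = sets borel" "sets \<Gamma>\<^sub>2 = sets borel"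
  using couplings_alg by (auto simp: space_prob_algebra)

lemma emeasure_middle:
  assumes "B \<in> sets borel"
  shows "emeasure \<Gamma>\<^sub>1 (UNIV \<times> B) = emeasure \<nu> B" "emeasure \<Gamma>\<^sub>2 (B \<times> UNIV) = emeasure \<nu> B"
  using couplingsD(5)[OF \<Gamma>\<^sub>1 _ _ assms] couplingsD(4)[OF \<Gamma>\<^sub>2 _ _ assms] alg by (auto simp: space_prob_algebra)

lemma emeasure_glued:
  assumes F: "finite F" "F \<subseteq> sets borel" and E: "E \<in> sets borel" and D: "D \<in> sets borel"
  shows "emeasure (glued F) (E \<times> D) = (\<Sum>S\<in>Pow F. ennreal (1 / measure \<nu> (block F S)) *
    (emeasure \<Gamma>\<^sub>1 (E \<inter> UNIV \<times> block F S) * emeasure \<Gamma>\<^sub>2 (block F S \<times> D)))"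
proof -
  interpret \<Gamma>\<^sub>1: prob_space \<Gamma>\<^sub>1 using couplings_alg by (simp add: space_prob_algebra)
  interpret \<Gamma>\<^sub>2: prob_space \<Gamma>\<^sub>2 using couplings_alg by (simp add: space_prob_algebra)
  note [measurable] = block_borel[OF F] E D
  have sets_prod: "sets (\<Gamma>\<^sub>1 \<Otimes>\<^sub>M \<Gamma>\<^sub>2) = sets ((borel \<Otimes>\<^sub>M borel) \<Otimes>\<^sub>M (borel \<Otimes>\<^sub>M borel))"
    using couplings_sets by (intro sets_pair_measure_cong) (simp_all only: borel_prod)
  note [measurable_cong] = sets_prod
  have map: "(\<lambda>(p, q). (p, snd q)) \<in> \<Gamma>\<^sub>1 \<Otimes>\<^sub>M \<Gamma>\<^sub>2 \<rightarrow>\<^sub>M borel"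
    unfolding borel_prod[symmetric] by measurable
  have dens: "glue_density F \<in> borel_measurable (\<Gamma>\<^sub>1 \<Otimes>\<^sub>M \<Gamma>\<^sub>2)"
    unfolding glue_density_def case_prod_beta by measurable
  have ED: "E \<times> D \<in> sets borel" by (intro borel_Times E D)
  have sets1: "E \<inter> UNIV \<times> block F S \<in> sets \<Gamma>\<^sub>1" for S
    using E couplings_sets by (simp add: borel_Times block_borel[OF F] sets.Int)
  have sets2: "block F S \<times> D \<in> sets \<Gamma>\<^sub>2" for S
    using D couplings_sets by (simp add: borel_Times block_borel[OF F])
  let ?T = "(\<lambda>(p, q). (p, snd q)) -` (E \<times> D) \<inter> space (\<Gamma>\<^sub>1 \<Otimes>\<^sub>M \<Gamma>\<^sub>2)"
  have T: "?T \<in> sets (\<Gamma>\<^sub>1 \<Otimes>\<^sub>M \<Gamma>\<^sub>2)" using map ED by (rule measurable_sets)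
  have "emeasure (glued F) (E \<times> D) = emeasure (density (\<Gamma>\<^sub>1 \<Otimes>\<^sub>M \<Gamma>\<^sub>2) (glue_density F)) ?T"
    unfolding glued_def using map ED by (subst emeasure_distr) auto
  also have "\<dots> = (\<integral>\<^sup>+x. glue_density F x * indicator ?T x \<partial>(\<Gamma>\<^sub>1 \<Otimes>\<^sub>M \<Gamma>\<^sub>2))"
    by (rule emeasure_density[OF dens T])
  also have "\<dots> = (\<integral>\<^sup>+x. (\<Sum>S\<in>Pow F. ennreal (1 / measure \<nu> (block F S)) *
      indicator ((E \<inter> UNIV \<times> block F S) \<times> (block F S \<times> D)) x) \<partial>(\<Gamma>\<^sub>1 \<Otimes>\<^sub>M \<Gamma>\<^sub>2))"
    by (intro nn_integral_cong)
      (auto simp: glue_density_def sum_distrib_right space_pair_measure indicator_def split: prod.splits intro!: sum.cong)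
  also have "\<dots> = (\<Sum>S\<in>Pow F. \<integral>\<^sup>+x. ennreal (1 / measure \<nu> (block F S)) *
      indicator ((E \<inter> UNIV \<times> block F S) \<times> (block F S \<times> D)) x \<partial>(\<Gamma>\<^sub>1 \<Otimes>\<^sub>M \<Gamma>\<^sub>2))"
    using sets1 sets2 by (intro nn_integral_sum) (auto intro!: borel_measurable_times_ennreal borel_measurable_indicator pair_measureI)
  also have "\<dots> = (\<Sum>S\<in>Pow F. ennreal (1 / measure \<nu> (block F S)) *
      (emeasure \<Gamma>\<^sub>1 (E \<inter> UNIV \<times> block F S) * emeasure \<Gamma>\<^sub>2 (block F S \<times> D)))"
    using sets1 sets2
    by (intro sum.cong refl) (simp add: nn_integral_cmult_indicator pair_measureI \<Gamma>\<^sub>2.emeasure_pair_measure_Times)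
  finally show ?thesis .
qed

text \<open>The weight \<open>1 / measure \<nu> B\<close> cancels the mass of the block even for null blocks: there it is \<open>1 / 0 = 0\<close>, and \<open>x\<close> vanishes too.\<close>

lemma block_weight:
  assumes "B \<in> sets borel" and le: "x \<le> emeasure \<nu> B"
  shows "ennreal (1 / measure \<nu> B) * (emeasure \<nu> B * x) = x"
proof -
  interpret \<nu>: prob_space \<nu> using alg by (simp add: space_prob_algebra)
  show ?thesis
  proof (cases "measure \<nu> B = 0")
    case True
    then show ?thesis using le by (simp add: \<nu>.emeasure_eq_measure)
  next
    case False
    then have "ennreal (1 / measure \<nu> B) * emeasure \<nu> B = 1"
      using measure_nonneg[of \<nu> B] by (simp add: \<nu>.emeasure_eq_measure flip: ennreal_mult)
    then show ?thesis by (simp flip: mult.assoc)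
  qed
qed

lemma emeasure_glued_fst:
  assumes F: "finite F" "F \<subseteq> sets borel" and E: "E \<in> sets borel"
  shows "emeasure (glued F) (E \<times> UNIV) = emeasure \<Gamma>\<^sub>1 E"
proof -
  have "ennreal (1 / measure \<nu> (block F S)) *
      (emeasure \<Gamma>\<^sub>1 (E \<inter> UNIV \<times> block F S) * emeasure \<Gamma>\<^sub>2 (block F S \<times> UNIV)) =
      emeasure \<Gamma>\<^sub>1 (E \<inter> snd -` block F S)" for S
  proof -
    have "emeasure \<Gamma>\<^sub>1 (E \<inter> UNIV \<times> block F S) \<le> emeasure \<Gamma>\<^sub>1 (UNIV \<times> block F S)"
      using couplings_sets by (intro emeasure_mono) (auto intro!: borel_Times block_borel[OF F])
    then have "emeasure \<Gamma>\<^sub>1 (E \<inter> UNIV \<times> block F S) \<le> emeasure \<nu> (block F S)"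
      by (simp add: emeasure_middle block_borel[OF F])
    from block_weight[OF block_borel[OF F] this]
    have "ennreal (1 / measure \<nu> (block F S)) *
        (emeasure \<Gamma>\<^sub>1 (E \<inter> UNIV \<times> block F S) * emeasure \<Gamma>\<^sub>2 (block F S \<times> UNIV)) =
        emeasure \<Gamma>\<^sub>1 (E \<inter> UNIV \<times> block F S)"
      by (simp add: emeasure_middle block_borel[OF F] mult.commute)
    moreover have "UNIV \<times> block F S = (snd -` block F S :: ('a \<times> 'b) set)" by auto
    ultimately show ?thesis by simp
  qed
  moreover have "snd \<in> borel_measurable (borel :: ('a \<times> 'b) measure)"
    unfolding borel_prod[symmetric] by measurable
  ultimately show ?thesis
    using sum_emeasure_blocks[OF F couplings_sets(1) E] by (simp add: emeasure_glued[OF F E])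
qed

text \<open>A middle set \<open>B\<close> is reproduced exactly if it is a union of blocks. Since \<open>F\<close> grows along the net, every Borel set
  eventually is one.\<close>

lemma emeasure_glued_snd:
  assumes F: "finite F" "F \<subseteq> sets borel" and B: "B = UNIV \<or> B \<in> F" and D: "D \<in> sets borel"
  shows "emeasure (glued F) ((UNIV \<times> B) \<times> D) = emeasure \<Gamma>\<^sub>2 (B \<times> D)"
proof -
  have B_borel: "B \<in> sets borel" using B F by auto
  have "ennreal (1 / measure \<nu> (block F S)) *
      (emeasure \<Gamma>\<^sub>1 (UNIV \<times> B \<inter> UNIV \<times> block F S) * emeasure \<Gamma>\<^sub>2 (block F S \<times> D)) =
      emeasure \<Gamma>\<^sub>2 (B \<times> D \<inter> fst -` block F S)" for S
  proof -
    consider "B \<inter> block F S = {}" | "block F S \<subseteq> B"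
      using B by (auto simp: block_def)
    then show ?thesis
    proof cases
      case 1
      then have "UNIV \<times> B \<inter> UNIV \<times> block F S = ({} :: ('a \<times> 'b) set)" "B \<times> D \<inter> fst -` block F S = {}"
        by auto
      then show ?thesis by simp
    next
      case 2
      have "emeasure \<Gamma>\<^sub>2 (block F S \<times> D) \<le> emeasure \<Gamma>\<^sub>2 (block F S \<times> UNIV)"
        using couplings_sets by (intro emeasure_mono) (auto intro!: borel_Times block_borel[OF F])
      then have "emeasure \<Gamma>\<^sub>2 (block F S \<times> D) \<le> emeasure \<nu> (block F S)"
        by (simp add: emeasure_middle block_borel[OF F])
      note weight = block_weight[OF block_borel[OF F] this]
      have "UNIV \<times> B \<inter> UNIV \<times> block F S = (UNIV :: 'a set) \<times> block F S"
        "B \<times> D \<inter> fst -` block F S = block F S \<times> D"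
        using 2 by auto
      then show ?thesis
        using weight by (simp add: emeasure_middle block_borel[OF F])
    qed
  qed
  moreover have "fst \<in> borel_measurable (borel :: ('b \<times> 'c) measure)"
    unfolding borel_prod[symmetric] by measurable
  ultimately show ?thesis
    using sum_emeasure_blocks[OF F couplings_sets(2) borel_Times[OF B_borel D]] B_borel
    by (simp add: emeasure_glued[OF F _ D] borel_Times)
qed

lemma glued_alg:
  assumes F: "finite F" "F \<subseteq> sets borel"
  shows "glued F \<in> space (prob_algebra borel)"
proof -
  interpret \<Gamma>\<^sub>1: prob_space \<Gamma>\<^sub>1 using couplings_alg by (simp add: space_prob_algebra)
  have "emeasure (glued F) (UNIV \<times> UNIV) = 1"
    using emeasure_glued_fst[OF F, of UNIV] \<Gamma>\<^sub>1.emeasure_space_1 sets_eq_imp_space_eq[OF couplings_sets(1)] by simp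
  then show ?thesis
    by (auto simp: space_prob_algebra glued_def intro!: prob_spaceI)
qed

text \<open>In the limit over all finite \<open>F\<close>, the first coupling is a marginal throughout, and the second one is recovered on
  every rectangle from some \<open>F\<close> on.\<close>

proposition ex_gluing:
  obtains \<Lambda> :: "(('a \<times> 'b) \<times> 'c) measure" where "\<Lambda> \<in> space (prob_algebra borel)"
    "distr \<Lambda> borel fst = \<Gamma>\<^sub>1" "distr \<Lambda> borel (\<lambda>((x, y), z). (y, z)) = \<Gamma>\<^sub>2"
proof -
  define \<F> where "\<F> = finite_subsets_at_top (sets (borel :: 'b measure))"
  have bot: "\<F> \<noteq> bot" by (simp add: \<F>_def finite_subsets_at_top_neq_bot)
  define \<Gamma> where "\<Gamma> F = (if finite F \<and> F \<subseteq> sets borel then glued F else glued {})" for F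
  have \<Gamma>_eq: "eventually (\<lambda>F. finite F \<and> F \<subseteq> sets borel \<and> \<Gamma> F = glued F \<and> B \<in> F) \<F>"
    if "B \<in> sets borel" for B
    unfolding \<F>_def eventually_finite_subsets_at_top using that by (intro exI[of _ "{B}"]) (auto simp: \<Gamma>_def)
  have \<Gamma>_alg: "\<Gamma> F \<in> space (prob_algebra borel)" for F
    by (auto simp: \<Gamma>_def intro: glued_alg)
  have fst: "((\<lambda>F. measure (\<Gamma> F) (E \<times> UNIV)) \<longlongrightarrow> measure \<Gamma>\<^sub>1 E) \<F>" if "E \<in> sets borel" for E
  proof -
    have "measure (\<Gamma> F) (E \<times> UNIV) = measure \<Gamma>\<^sub>1 E" for F
      using that by (simp add: measure_def \<Gamma>_def emeasure_glued_fst)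
    then show ?thesis by simp
  qed
  have snd: "((\<lambda>F. measure (\<Gamma> F) (UNIV \<times> D)) \<longlongrightarrow> measure \<rho> D) \<F>" if "D \<in> sets borel" for D
  proof -
    have "emeasure \<Gamma>\<^sub>2 (UNIV \<times> D) = emeasure \<rho> D"
      using couplingsD(5)[OF \<Gamma>\<^sub>2] alg that by (simp add: space_prob_algebra)
    then have "measure (\<Gamma> F) (UNIV \<times> D) = measure \<rho> D" for F
      using that emeasure_glued_snd[of F UNIV D] emeasure_glued_snd[of "{}" UNIV D]
      by (simp add: measure_def \<Gamma>_def)
    then show ?thesis by simp
  qed
  obtain G \<Lambda> where G: "G \<le> \<F>" "G \<noteq> bot" and \<Lambda>: "\<Lambda> \<in> couplings \<Gamma>\<^sub>1 \<rho>"
    and lim: "\<And>\<R>. finite \<R> \<Longrightarrow> \<R> \<subseteq> borel_rectangles \<Longrightarrow>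
       ((\<lambda>F. measure (\<Gamma> F) (\<Union>\<R>)) \<longlongrightarrow> measure \<Lambda> (\<Union>\<R>)) G"
  proof (rule ex_limit_coupling[of \<F> \<Gamma> \<Gamma>\<^sub>1 \<rho>])
    fix G \<Lambda> assume "G \<le> \<F>" "G \<noteq> bot" "\<Lambda> \<in> couplings \<Gamma>\<^sub>1 \<rho>"
      "\<And>\<R>. finite \<R> \<Longrightarrow> \<R> \<subseteq> borel_rectangles \<Longrightarrow>
       ((\<lambda>F. measure (\<Gamma> F) (\<Union>\<R>)) \<longlongrightarrow> measure \<Lambda> (\<Union>\<R>)) G"
    then show thesis by (rule that)
  qed (rule bot \<Gamma>_alg couplings_alg alg fst snd; assumption?)+
  have \<Lambda>_alg: "\<Lambda> \<in> space (prob_algebra borel)" and \<Lambda>_fst: "distr \<Lambda> borel fst = \<Gamma>\<^sub>1"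
    using couplingsD(1,2)[OF \<Lambda>] couplings_sets alg by (auto simp: space_prob_algebra)
  then interpret \<Lambda>: prob_space \<Lambda> by (simp add: space_prob_algebra)
  interpret \<Gamma>\<^sub>2: prob_space \<Gamma>\<^sub>2 using couplings_alg by (simp add: space_prob_algebra)
  have \<Lambda>_sets: "sets \<Lambda> = sets borel" using \<Lambda>_alg by (simp add: space_prob_algebra)
  have space_\<Lambda>: "space \<Lambda> = UNIV" using sets_eq_imp_space_eq[OF \<Lambda>_sets] by simp
  have proj: "(\<lambda>((x, y), z). (y, z)) \<in> \<Lambda> \<rightarrow>\<^sub>M borel"
    unfolding measurable_cong_sets[OF \<Lambda>_sets refl] by (rule borel_measurable_prod_projections)
  have "distr \<Lambda> borel (\<lambda>((x, y), z). (y, z)) = \<Gamma>\<^sub>2"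
  proof (rule measure_eqI_borel_rectangles)
    show "distr \<Lambda> borel (\<lambda>((x, y), z). (y, z)) \<in> space (prob_algebra borel)"
      using \<Lambda>.prob_space_distr[OF proj] by (simp add: space_prob_algebra)
    show "\<Gamma>\<^sub>2 \<in> space (prob_algebra borel)" by (rule couplings_alg)
    fix B :: "'b set" and D :: "'c set" assume B: "B \<in> sets borel" and D: "D \<in> sets borel"
    have "((\<lambda>F. measure (\<Gamma> F) ((UNIV \<times> B) \<times> D)) \<longlongrightarrow> measure \<Lambda> ((UNIV \<times> B) \<times> D)) G"
      using lim[of "{(UNIV \<times> B) \<times> D}"] B D by (simp add: borel_rectanglesI borel_Times)
    moreover have "eventually (\<lambda>F. measure (\<Gamma> F) ((UNIV \<times> B) \<times> D) = measure \<Gamma>\<^sub>2 (B \<times> D)) \<F>"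
      using \<Gamma>_eq[OF B] by eventually_elim (simp add: measure_def emeasure_glued_snd D)
    then have "eventually (\<lambda>F. measure (\<Gamma> F) ((UNIV \<times> B) \<times> D) = measure \<Gamma>\<^sub>2 (B \<times> D)) G"
      using G(1) by (rule filter_leD[rotated])
    then have "((\<lambda>F. measure (\<Gamma> F) ((UNIV \<times> B) \<times> D)) \<longlongrightarrow> measure \<Gamma>\<^sub>2 (B \<times> D)) G"
      by (rule tendsto_eventually)
    ultimately have "measure \<Lambda> ((UNIV \<times> B) \<times> D) = measure \<Gamma>\<^sub>2 (B \<times> D)"
      by (rule tendsto_unique[OF G(2)])
    moreover have "emeasure (distr \<Lambda> borel (\<lambda>((x, y), z). (y, z))) (B \<times> D) = emeasure \<Lambda> ((UNIV \<times> B) \<times> D)"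
      unfolding emeasure_distr[OF proj borel_Times[OF B D]]
      by (intro arg_cong[of _ _ "emeasure \<Lambda>"]) (auto simp: space_\<Lambda>)
    ultimately show "emeasure (distr \<Lambda> borel (\<lambda>((x, y), z). (y, z))) (B \<times> D) = emeasure \<Gamma>\<^sub>2 (B \<times> D)"
      by (simp add: \<Lambda>.emeasure_eq_measure \<Gamma>\<^sub>2.emeasure_eq_measure)
  qed
  then show ?thesis using \<Lambda>_alg \<Lambda>_fst by (intro that)
qed

end

lemma ennreal_less_add_pos:
  fixes x :: ennreal
  assumes "x < top" "0 < h"
  shows "x < x + ennreal h"
  using assms ennreal_add_left_cancel_less[of x 0 "ennreal h"] by (simp add: less_top)

text \<open>Nearly optimal couplings are glued along the middle measure. The outer two coordinates then form a coupling of \<open>\<mu>\<close> and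
  \<open>\<rho>\<close>, and the pointwise inequality is integrated.\<close>

proposition transport_cost_weak_triangle:
  fixes \<mu> :: "'a::polish_space measure" and \<nu> :: "'b::polish_space measure" and \<rho> :: "'c::polish_space measure"
  assumes alg: "\<mu> \<in> space (prob_algebra borel)" "\<nu> \<in> space (prob_algebra borel)"
      "\<rho> \<in> space (prob_algebra borel)"
    and meas[measurable]: "c\<^sub>1 \<in> borel_measurable borel" "c\<^sub>2 \<in> borel_measurable borel" "c\<^sub>3 \<in> borel_measurable borel"
    and nonneg: "\<And>p. 0 \<le> c\<^sub>1 p" "\<And>p. 0 \<le> c\<^sub>2 p"
    and C: "0 < C"
    and triangle: "\<And>x y z. c\<^sub>3 (x, z) \<le> C * (c\<^sub>1 (x, y) + c\<^sub>2 (y, z))"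
  shows "transport_cost c\<^sub>3 \<mu> \<rho> \<le> ennreal C * (transport_cost c\<^sub>1 \<mu> \<nu> + transport_cost c\<^sub>2 \<nu> \<rho>)"
proof (rule ennreal_le_epsilon)
  fix e :: real
  assume fin: "ennreal C * (transport_cost c\<^sub>1 \<mu> \<nu> + transport_cost c\<^sub>2 \<nu> \<rho>) < top" and "0 < e"
  define h where "h = e / (2 * C)"
  have h: "0 < h" "C * (h + h) = e" using C \<open>0 < e\<close> by (auto simp: h_def)
  have cost_finite: "transport_cost c\<^sub>1 \<mu> \<nu> < top" "transport_cost c\<^sub>2 \<nu> \<rho> < top"
    using fin C by (auto simp: ennreal_mult_less_top)
  obtain \<Gamma>\<^sub>1 where \<Gamma>\<^sub>1: "\<Gamma>\<^sub>1 \<in> couplings \<mu> \<nu>"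
      "(\<integral>\<^sup>+p. ennreal (c\<^sub>1 p) \<partial>\<Gamma>\<^sub>1) < transport_cost c\<^sub>1 \<mu> \<nu> + ennreal h"
    by (rule ex_coupling_less[OF ennreal_less_add_pos[OF cost_finite(1) h(1)]])
  obtain \<Gamma>\<^sub>2 where \<Gamma>\<^sub>2: "\<Gamma>\<^sub>2 \<in> couplings \<nu> \<rho>"
      "(\<integral>\<^sup>+p. ennreal (c\<^sub>2 p) \<partial>\<Gamma>\<^sub>2) < transport_cost c\<^sub>2 \<nu> \<rho> + ennreal h"
    by (rule ex_coupling_less[OF ennreal_less_add_pos[OF cost_finite(2) h(1)]])
  obtain \<Lambda> :: "(('a \<times> 'b) \<times> 'c) measure" where \<Lambda>: "\<Lambda> \<in> space (prob_algebra borel)"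
    "distr \<Lambda> borel fst = \<Gamma>\<^sub>1" "distr \<Lambda> borel (\<lambda>((x, y), z). (y, z)) = \<Gamma>\<^sub>2"
    by (rule ex_gluing[OF alg \<Gamma>\<^sub>1(1) \<Gamma>\<^sub>2(1)])
  interpret \<Lambda>: prob_space \<Lambda> using \<Lambda> by (simp add: space_prob_algebra)
  have \<Lambda>_sets: "sets \<Lambda> = sets borel" using \<Lambda> by (simp add: space_prob_algebra)
  have space_\<Lambda>: "space \<Lambda> = UNIV" using sets_eq_imp_space_eq[OF \<Lambda>_sets] by simp
  have proj: "fst \<in> \<Lambda> \<rightarrow>\<^sub>M borel" "(\<lambda>((x, y), z). (y, z)) \<in> \<Lambda> \<rightarrow>\<^sub>M borel"
      "(\<lambda>((x, y), z). (x, z)) \<in> \<Lambda> \<rightarrow>\<^sub>M borel"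
    unfolding measurable_cong_sets[OF \<Lambda>_sets refl]
    by (rule borel_measurable_prod_projections borel_measurable_continuous_onI[OF continuous_on_fst[OF continuous_on_id]])+
  let ?\<Gamma> = "distr \<Lambda> borel (\<lambda>((x, y), z). (x, z))"
  have "?\<Gamma> \<in> couplings \<mu> \<rho>"
  proof (rule couplingsI[OF alg(1,3)])
    fix A :: "'a set" assume A: "A \<in> sets borel"
    have "emeasure ?\<Gamma> (A \<times> UNIV) = emeasure \<Lambda> ((A \<times> UNIV) \<times> UNIV)"
      using A proj by (subst emeasure_distr) (auto intro!: borel_Times arg_cong[of _ _ "emeasure \<Lambda>"] simp: space_\<Lambda>)
    also have "\<dots> = emeasure \<Gamma>\<^sub>1 (A \<times> UNIV)"
      unfolding \<Lambda>(2)[symmetric]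
      using A proj by (subst emeasure_distr) (auto intro!: borel_Times arg_cong[of _ _ "emeasure \<Lambda>"] simp: space_\<Lambda>)
    also have "\<dots> = emeasure \<mu> A"
      using couplingsD(4)[OF \<Gamma>\<^sub>1(1) _ _ A] alg by (simp add: space_prob_algebra)
    finally show "emeasure ?\<Gamma> (A \<times> UNIV) = emeasure \<mu> A" .
  next
    fix B :: "'c set" assume B: "B \<in> sets borel"
    have "emeasure ?\<Gamma> (UNIV \<times> B) = emeasure \<Lambda> (UNIV \<times> B)"
      using B proj by (subst emeasure_distr) (auto intro!: borel_Times arg_cong[of _ _ "emeasure \<Lambda>"] simp: space_\<Lambda>)
    also have "\<dots> = emeasure \<Gamma>\<^sub>2 (UNIV \<times> B)"
      unfolding \<Lambda>(3)[symmetric]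
      using B proj by (subst emeasure_distr) (auto intro!: borel_Times arg_cong[of _ _ "emeasure \<Lambda>"] simp: space_\<Lambda>)
    also have "\<dots> = emeasure \<rho> B"
      using couplingsD(5)[OF \<Gamma>\<^sub>2(1) _ _ B] alg by (simp add: space_prob_algebra)
    finally show "emeasure ?\<Gamma> (UNIV \<times> B) = emeasure \<rho> B" .
  qed simp
  then have "transport_cost c\<^sub>3 \<mu> \<rho> \<le> (\<integral>\<^sup>+p. ennreal (c\<^sub>3 p) \<partial>?\<Gamma>)"
    by (rule transport_cost_le)
  also have "\<dots> = (\<integral>\<^sup>+w. ennreal (c\<^sub>3 ((\<lambda>((x, y), z). (x, z)) w)) \<partial>\<Lambda>)"
    using proj by (subst nn_integral_distr) auto
  also have "\<dots> \<le> (\<integral>\<^sup>+w. ennreal C * (ennreal (c\<^sub>1 (fst w)) + ennreal (c\<^sub>2 ((\<lambda>((x, y), z). (y, z)) w))) \<partial>\<Lambda>)"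
    using triangle nonneg C
    by (intro nn_integral_mono) (auto simp: ennreal_leI simp flip: ennreal_plus ennreal_mult split: prod.splits)
  also have "\<dots> = ennreal C * ((\<integral>\<^sup>+w. ennreal (c\<^sub>1 (fst w)) \<partial>\<Lambda>) + (\<integral>\<^sup>+w. ennreal (c\<^sub>2 ((\<lambda>((x, y), z). (y, z)) w)) \<partial>\<Lambda>))"
    using measurable_compose[OF proj(1) meas(1)] measurable_compose[OF proj(2) meas(2)]
    by (subst nn_integral_cmult) (auto simp: nn_integral_add)
  also have "(\<integral>\<^sup>+w. ennreal (c\<^sub>1 (fst w)) \<partial>\<Lambda>) = (\<integral>\<^sup>+p. ennreal (c\<^sub>1 p) \<partial>\<Gamma>\<^sub>1)"
    unfolding \<Lambda>(2)[symmetric] using proj by (subst nn_integral_distr) auto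
  also have "(\<integral>\<^sup>+w. ennreal (c\<^sub>2 ((\<lambda>((x, y), z). (y, z)) w)) \<partial>\<Lambda>) = (\<integral>\<^sup>+p. ennreal (c\<^sub>2 p) \<partial>\<Gamma>\<^sub>2)"
    unfolding \<Lambda>(3)[symmetric] using proj by (subst nn_integral_distr) auto
  also have "ennreal C * ((\<integral>\<^sup>+p. ennreal (c\<^sub>1 p) \<partial>\<Gamma>\<^sub>1) + (\<integral>\<^sup>+p. ennreal (c\<^sub>2 p) \<partial>\<Gamma>\<^sub>2)) \<le>
      ennreal C * ((transport_cost c\<^sub>1 \<mu> \<nu> + ennreal h) + (transport_cost c\<^sub>2 \<nu> \<rho> + ennreal h))"
    using \<Gamma>\<^sub>1(2) \<Gamma>\<^sub>2(2) by (intro mult_left_mono add_mono) (auto intro: less_imp_le)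
  also have "\<dots> = ennreal C * ((transport_cost c\<^sub>1 \<mu> \<nu> + transport_cost c\<^sub>2 \<nu> \<rho>) + ennreal (h + h))"
    using h(1) by (simp only: ennreal_plus less_imp_le ac_simps)
  also have "\<dots> = ennreal C * (transport_cost c\<^sub>1 \<mu> \<nu> + transport_cost c\<^sub>2 \<nu> \<rho>) + ennreal (C * (h + h))"
    using h(1) C ennreal_mult[of C "h + h"] by (simp add: distrib_left[of "ennreal C"] del: ennreal_plus)
  also have "\<dots> = ennreal C * (transport_cost c\<^sub>1 \<mu> \<nu> + transport_cost c\<^sub>2 \<nu> \<rho>) + ennreal e"
    by (simp only: h)
  finally show "transport_cost c\<^sub>3 \<mu> \<rho> \<le> \<dots>" .
qed

section \<open>Symmetry and contraction of the transport cost\<close>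

lemma transport_cost_commute_le:
  fixes \<mu> \<nu> :: "'a::polish_space measure"
  assumes alg: "\<mu> \<in> space (prob_algebra borel)" "\<nu> \<in> space (prob_algebra borel)"
    and c: "c \<in> borel_measurable borel" "\<And>x y. c (x, y) = c (y, x)"
  shows "transport_cost c \<mu> \<nu> \<le> transport_cost c \<nu> \<mu>"
  unfolding transport_cost_def[of c \<nu> \<mu>]
proof (rule INF_greatest)
  fix \<Gamma> assume \<Gamma>: "\<Gamma> \<in> couplings \<nu> \<mu>"
  have sets: "sets \<mu> = sets borel" "sets \<nu> = sets borel" using alg by (auto simp: space_prob_algebra)
  have \<Gamma>_sets: "sets \<Gamma> = sets borel"
    using couplingsD(1)[OF \<Gamma> sets(2,1)] by (auto simp: space_prob_algebra)
  have [simp]: "space \<Gamma> = UNIV" using sets_eq_imp_space_eq[OF \<Gamma>_sets] by simp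
  have swap: "prod.swap \<in> \<Gamma> \<rightarrow>\<^sub>M borel"
    unfolding measurable_cong_sets[OF \<Gamma>_sets refl] prod.swap_def borel_prod[symmetric] by measurable
  have "distr \<Gamma> borel prod.swap \<in> couplings \<mu> \<nu>"
  proof (rule couplingsI[OF alg])
    fix A :: "'a set" assume A: "A \<in> sets borel"
    have "prod.swap -` (A \<times> UNIV) = (UNIV :: 'a set) \<times> A" "prod.swap -` (UNIV \<times> A) = A \<times> (UNIV :: 'a set)"
      by auto
    then show "emeasure (distr \<Gamma> borel prod.swap) (A \<times> UNIV) = emeasure \<mu> A"
      "emeasure (distr \<Gamma> borel prod.swap) (UNIV \<times> A) = emeasure \<nu> A"
      using couplingsD(4,5)[OF \<Gamma> sets(2,1) A] A
      by (simp_all add: emeasure_distr[OF swap] borel_Times)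
  qed simp
  then have "transport_cost c \<mu> \<nu> \<le> (\<integral>\<^sup>+p. ennreal (c p) \<partial>distr \<Gamma> borel prod.swap)"
    by (rule transport_cost_le)
  also have "\<dots> = (\<integral>\<^sup>+p. ennreal (c (prod.swap p)) \<partial>\<Gamma>)"
    using swap c(1) by (subst nn_integral_distr) auto
  also have "\<dots> = (\<integral>\<^sup>+p. ennreal (c p) \<partial>\<Gamma>)"
    using c(2) by (intro nn_integral_cong) (auto simp: prod.swap_def)
  finally show "transport_cost c \<mu> \<nu> \<le> (\<integral>\<^sup>+p. ennreal (c p) \<partial>\<Gamma>)" .
qed

lemma transport_cost_commute:
  fixes \<mu> \<nu> :: "'a::polish_space measure"
  assumes "\<mu> \<in> space (prob_algebra borel)" "\<nu> \<in> space (prob_algebra borel)"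
    and "c \<in> borel_measurable borel" "\<And>x y. c (x, y) = c (y, x)"
  shows "transport_cost c \<mu> \<nu> = transport_cost c \<nu> \<mu>"
  using transport_cost_commute_le assms by (intro antisym) auto

lemma transport_cost_self:
  fixes \<mu> :: "'a::polish_space measure"
  assumes \<mu>: "\<mu> \<in> space (prob_algebra borel)" and c: "c \<in> borel_measurable borel" "\<And>x. c (x, x) = 0"
  shows "transport_cost c \<mu> \<mu> = 0"
proof -
  have sets: "sets \<mu> = sets borel" using \<mu> by (auto simp: space_prob_algebra)
  have [simp]: "space \<mu> = UNIV" using sets_eq_imp_space_eq[OF sets] by simp
  have diag: "(\<lambda>x. (x, x)) \<in> \<mu> \<rightarrow>\<^sub>M borel"
    unfolding measurable_cong_sets[OF sets refl] borel_prod[symmetric] by measurable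
  have "distr \<mu> borel (\<lambda>x. (x, x)) \<in> couplings \<mu> \<mu>"
  proof (rule couplingsI[OF \<mu> \<mu>])
    fix A :: "'a set" assume A: "A \<in> sets borel"
    have "(\<lambda>x. (x, x)) -` (A \<times> UNIV) = A" "(\<lambda>x. (x, x)) -` (UNIV \<times> A) = A" by auto
    then show "emeasure (distr \<mu> borel (\<lambda>x. (x, x))) (A \<times> UNIV) = emeasure \<mu> A"
      "emeasure (distr \<mu> borel (\<lambda>x. (x, x))) (UNIV \<times> A) = emeasure \<mu> A"
      using A by (simp_all add: emeasure_distr[OF diag] borel_Times)
  qed simp
  then have "transport_cost c \<mu> \<mu> \<le> (\<integral>\<^sup>+p. ennreal (c p) \<partial>distr \<mu> borel (\<lambda>x. (x, x)))"
    by (rule transport_cost_le)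
  also have "\<dots> = 0"
    using diag c by (subst nn_integral_distr) auto
  finally show ?thesis by simp
qed

lemma pair_measure_coupling:
  fixes \<mu> :: "'a::polish_space measure" and \<nu> :: "'b::polish_space measure"
  assumes \<mu>: "\<mu> \<in> space (prob_algebra borel)" and \<nu>: "\<nu> \<in> space (prob_algebra borel)"
  shows "\<mu> \<Otimes>\<^sub>M \<nu> \<in> couplings \<mu> \<nu>"
proof -
  interpret \<mu>: prob_space \<mu> using \<mu> by (simp add: space_prob_algebra)
  interpret \<nu>: prob_space \<nu> using \<nu> by (simp add: space_prob_algebra)
  have sets: "sets \<mu> = sets borel" "sets \<nu> = sets borel" using \<mu> \<nu> by (auto simp: space_prob_algebra)
  have space: "space \<mu> = UNIV" "space \<nu> = UNIV"
    using sets[THEN sets_eq_imp_space_eq] by auto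
  have UNIV: "UNIV \<in> sets \<mu>" "UNIV \<in> sets \<nu>" using sets by auto
  show ?thesis
  proof (rule couplingsI[OF \<mu> \<nu>])
    show "sets (\<mu> \<Otimes>\<^sub>M \<nu>) = sets borel"
      using sets_pair_measure_cong[OF sets, unfolded borel_prod] .
    show "emeasure (\<mu> \<Otimes>\<^sub>M \<nu>) (A \<times> UNIV) = emeasure \<mu> A" if "A \<in> sets borel" for A
      using \<nu>.emeasure_pair_measure_Times[of A \<mu> UNIV] \<nu>.emeasure_space_1 that UNIV space sets by simp
    show "emeasure (\<mu> \<Otimes>\<^sub>M \<nu>) (UNIV \<times> B) = emeasure \<nu> B" if "B \<in> sets borel" for B
      using \<nu>.emeasure_pair_measure_Times[of UNIV \<mu> B] \<mu>.emeasure_space_1 that UNIV space sets by simp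
  qed
qed

lemma kernel_pow_measurable:
  assumes P: "P \<in> borel \<rightarrow>\<^sub>M prob_algebra borel"
  shows "kernel_pow P n \<in> borel \<rightarrow>\<^sub>M prob_algebra borel"
proof (induction n)
  case (Suc n)
  then show ?case
    using measurable_bind_prob_space[OF Suc P] by simp
qed simp

lemma kernel_pow_in_prob_algebra:
  assumes "P \<in> borel \<rightarrow>\<^sub>M prob_algebra borel"
  shows "kernel_pow P n x \<in> space (prob_algebra borel)"
  using measurable_space[OF kernel_pow_measurable[OF assms]] by simp

lemma measurable_of_prob_algebra:
  assumes "\<mu> \<in> space (prob_algebra N)"
  shows "measurable \<mu> L = measurable N L"
  using assms by (intro measurable_cong_sets) (auto simp: space_prob_algebra)

lemma bind_kernel_pow_Suc:
  assumes P: "P \<in> borel \<rightarrow>\<^sub>M prob_algebra borel" and \<mu>: "\<mu> \<in> space (prob_algebra borel)"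
  shows "\<mu> \<bind> kernel_pow P (Suc n) = (\<mu> \<bind> kernel_pow P n) \<bind> P"
  using measurable_prob_algebraD[OF kernel_pow_measurable[OF P]] measurable_prob_algebraD[OF P]
  by (subst bind_assoc[of _ _ borel _ borel]) (auto simp: measurable_of_prob_algebra[OF \<mu>])

lemma bind_kernel_pow_0:
  assumes \<mu>: "\<mu> \<in> space (prob_algebra borel)"
  shows "\<mu> \<bind> kernel_pow P 0 = \<mu>"
  using \<mu> by (simp add: bind_return'' space_prob_algebra)

text \<open>A coupling of \<open>\<mu>\<close> and \<open>\<nu>\<close> is the mixing measure here, with the kernels \<open>P\<close> of the first and of the second coordinate.\<close>

lemma transport_cost_bind_contraction:
  fixes P :: "'a::polish_space \<Rightarrow> 'a measure"
  assumes P: "P \<in> borel \<rightarrow>\<^sub>M prob_algebra borel"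
    and alg: "\<mu> \<in> space (prob_algebra borel)" "\<nu> \<in> space (prob_algebra borel)"
    and c: "lower_semicontinuous c" "\<And>p. 0 \<le> c p" and \<alpha>: "0 < \<alpha>"
    and contraction: "\<And>x y. transport_cost c (P x) (P y) \<le> ennreal (\<alpha> * c (x, y))"
  shows "transport_cost c (\<mu> \<bind> P) (\<nu> \<bind> P) \<le> ennreal \<alpha> * transport_cost c \<mu> \<nu>"
proof -
  let ?T = "transport_cost c (\<mu> \<bind> P) (\<nu> \<bind> P)"
  have [measurable]: "c \<in> borel_measurable borel" using c(1) by (rule lower_semicontinuous_borel)
  have \<alpha>_inv: "ennreal (1 / \<alpha>) * (ennreal \<alpha> * y) = y" "ennreal \<alpha> * (ennreal (1 / \<alpha>) * y) = y" for y
    using \<alpha> by (simp_all flip: mult.assoc ennreal_mult)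
  have "ennreal (1 / \<alpha>) * ?T \<le> transport_cost c \<mu> \<nu>"
    unfolding transport_cost_def[of c \<mu> \<nu>]
  proof (rule INF_greatest)
    fix \<Gamma> assume \<Gamma>: "\<Gamma> \<in> couplings \<mu> \<nu>"
    note \<Gamma>D = couplingsD[OF \<Gamma>] 
    have \<Gamma>_alg: "\<Gamma> \<in> space (prob_algebra borel)" and marginals: "distr \<Gamma> borel fst = \<mu>" "distr \<Gamma> borel snd = \<nu>"
      using \<Gamma>D(1-3) alg by (auto simp: space_prob_algebra)
    interpret \<Gamma>: prob_space \<Gamma> using \<Gamma>_alg by (simp add: space_prob_algebra)
    have sets[measurable_cong]: "sets \<Gamma> = sets borel" using \<Gamma>_alg by (simp add: space_prob_algebra)
    have proj: "fst \<in> \<Gamma> \<rightarrow>\<^sub>M borel" "snd \<in> \<Gamma> \<rightarrow>\<^sub>M borel"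
      unfolding measurable_cong_sets[OF sets refl] by (auto simp: borel_prod[symmetric])
    have bind: "\<mu> \<bind> P = \<Gamma> \<bind> (\<lambda>p. P (fst p))" "\<nu> \<bind> P = \<Gamma> \<bind> (\<lambda>p. P (snd p))"
      using marginals bind_distr[OF proj(1) measurable_prob_algebraD[OF P]]
        bind_distr[OF proj(2) measurable_prob_algebraD[OF P]] \<Gamma>.not_empty by simp_all
    have "?T \<le> (\<integral>\<^sup>+p. ennreal (\<alpha> * c p) \<partial>\<Gamma>)"
      unfolding bind
    proof (rule transport_cost_bind_le[OF \<Gamma>.prob_space_axioms _ _ c])
      show "(\<lambda>p. P (fst p)) \<in> \<Gamma> \<rightarrow>\<^sub>M prob_algebra borel" "(\<lambda>p. P (snd p)) \<in> \<Gamma> \<rightarrow>\<^sub>M prob_algebra borel"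
        using measurable_compose[OF proj(1) P] measurable_compose[OF proj(2) P] .
      show "(\<lambda>p. \<alpha> * c p) \<in> borel_measurable \<Gamma>" by measurable
      show "0 \<le> \<alpha> * c p" for p using \<alpha> c(2) by simp
      show "transport_cost c (P (fst p)) (P (snd p)) \<le> ennreal (\<alpha> * c p)" for p
        using contraction[of "fst p" "snd p"] by simp
    qed
    also have "\<dots> = ennreal \<alpha> * (\<integral>\<^sup>+p. ennreal (c p) \<partial>\<Gamma>)"
      using \<alpha> c(2) by (simp add: ennreal_mult nn_integral_cmult)
    finally have "ennreal (1 / \<alpha>) * ?T \<le> ennreal (1 / \<alpha>) * (ennreal \<alpha> * (\<integral>\<^sup>+p. ennreal (c p) \<partial>\<Gamma>))"
      by (rule mult_left_mono) simp
    then show "ennreal (1 / \<alpha>) * ?T \<le> (\<integral>\<^sup>+p. ennreal (c p) \<partial>\<Gamma>)"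
      by (simp only: \<alpha>_inv)
  qed
  then have "ennreal \<alpha> * (ennreal (1 / \<alpha>) * ?T) \<le> ennreal \<alpha> * transport_cost c \<mu> \<nu>"
    by (rule mult_left_mono) simp
  then show ?thesis by (simp only: \<alpha>_inv)
qed

lemma transport_cost_bind_kernel_pow_contraction:
  fixes P :: "'a::polish_space \<Rightarrow> 'a measure"
  assumes P: "P \<in> borel \<rightarrow>\<^sub>M prob_algebra borel"
    and alg: "\<mu> \<in> space (prob_algebra borel)" "\<nu> \<in> space (prob_algebra borel)"
    and c: "lower_semicontinuous c" "\<And>p. 0 \<le> c p" and \<alpha>: "0 < \<alpha>"
    and contraction: "\<And>x y. transport_cost c (P x) (P y) \<le> ennreal (\<alpha> * c (x, y))"
  shows "transport_cost c (\<mu> \<bind> kernel_pow P n) (\<nu> \<bind> kernel_pow P n) \<le> ennreal (\<alpha> ^ n) * transport_cost c \<mu> \<nu>"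
proof (induction n)
  case 0
  then show ?case by (simp add: bind_kernel_pow_0[OF alg(1), simplified] bind_kernel_pow_0[OF alg(2), simplified])
next
  case (Suc n)
  have alg': "\<mu> \<bind> kernel_pow P n \<in> space (prob_algebra borel)" "\<nu> \<bind> kernel_pow P n \<in> space (prob_algebra borel)"
    using bind_in_prob_algebra[OF _ kernel_pow_measurable[OF P]] alg by auto
  have "transport_cost c (\<mu> \<bind> kernel_pow P (Suc n)) (\<nu> \<bind> kernel_pow P (Suc n)) \<le>
      ennreal \<alpha> * transport_cost c (\<mu> \<bind> kernel_pow P n) (\<nu> \<bind> kernel_pow P n)"
    unfolding bind_kernel_pow_Suc[OF P alg(1)] bind_kernel_pow_Suc[OF P alg(2)]
    by (rule transport_cost_bind_contraction[OF P alg' c \<alpha> contraction])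
  also have "\<dots> \<le> ennreal \<alpha> * (ennreal (\<alpha> ^ n) * transport_cost c \<mu> \<nu>)"
    by (rule mult_left_mono[OF Suc]) simp
  also have "\<dots> = ennreal (\<alpha> ^ Suc n) * transport_cost c \<mu> \<nu>"
    using \<alpha> by (simp add: ennreal_mult mult.assoc)
  finally show ?case .
qed

lemma bind_invariant_kernel_pow:
  assumes P: "P \<in> borel \<rightarrow>\<^sub>M prob_algebra borel" and \<mu>: "invariant_prob P \<mu>"
  shows "\<mu> \<bind> kernel_pow P n = \<mu>"
proof (induction n)
  case 0
  show ?case using \<mu> by (intro bind_kernel_pow_0) (simp add: invariant_prob_def)
next
  case (Suc n)
  then show ?case using bind_kernel_pow_Suc[OF P, of \<mu> n] \<mu> by (simp add: invariant_prob_def del: kernel_pow.simps)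
qed

section \<open>Lyapunov functions\<close>

text \<open>Integrating the drift condition against \<open>\<mu>\<close> would subtract infinite integrals. Truncation at \<open>M\<close> avoids this: invariance
  gives \<open>\<mu>(min V M) \<le> \<mu>(min (\<gamma> V + K) M)\<close>, both sides finite, and the integrands differ by at least \<open>(1 - \<gamma>) V - K\<close>
  where \<open>V < M\<close> and by at least \<open>- K\<close> elsewhere.\<close>

lemma nn_integral_lyapunov_invariant_le:
  assumes P: "P \<in> borel \<rightarrow>\<^sub>M prob_algebra borel" and \<mu>: "invariant_prob P \<mu>"
    and V: "lyapunov_with P V \<gamma> K"
  shows "(\<integral>\<^sup>+x. ennreal (V x) \<partial>\<mu>) \<le> ennreal (K / (1 - \<gamma>))"
proof -
  have alg: "\<mu> \<in> space (prob_algebra borel)" and inv: "\<mu> \<bind> P = \<mu>"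
    using \<mu> by (auto simp: invariant_prob_def)
  interpret prob_space \<mu> using alg by (simp add: space_prob_algebra)
  have sets[measurable_cong]: "sets \<mu> = sets borel" using alg by (simp add: space_prob_algebra)
  have V_meas[measurable]: "V \<in> borel_measurable borel" and V_nonneg: "\<And>x. 0 \<le> V x"
    and \<gamma>: "0 < \<gamma>" "\<gamma> < 1" and K: "0 < K"
    and drift: "\<And>x. (\<integral>\<^sup>+y. ennreal (V y) \<partial>P x) \<le> ennreal (\<gamma> * V x + K)"
    using V by (auto simp: lyapunov_with_def)
  have P_prob: "prob_space (P x)" "sets (P x) = sets borel" for x
    using measurable_space[OF P, of x] by (auto simp: space_prob_algebra)
  have truncated: "(\<integral>\<^sup>+x. ennreal (V x) * indicator {x. V x < M} x \<partial>\<mu>) \<le> ennreal (K / (1 - \<gamma>))"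
    if "0 \<le> M" for M
  proof -
    \<comment> \<open>\<open>?V\<close> is the truncation, and \<open>?G\<close> bounds its image under \<open>P\<close>.\<close>
    let ?V = "\<lambda>x. ennreal (min (V x) M)" and ?G = "\<lambda>x. ennreal (min (\<gamma> * V x + K) M)"
    let ?I = "\<integral>\<^sup>+x. ennreal (V x) * indicator {x. V x < M} x \<partial>\<mu>"
    have "(\<integral>\<^sup>+x. ?V x \<partial>\<mu>) = (\<integral>\<^sup>+x. ?V x \<partial>(\<mu> \<bind> P))" by (simp only: inv)
    also have "\<dots> = (\<integral>\<^sup>+x. \<integral>\<^sup>+y. ?V y \<partial>P x \<partial>\<mu>)"
      using measurable_prob_algebraD[OF P] by (intro nn_integral_bind[of _ borel]) (auto simp: measurable_of_prob_algebra[OF alg])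
    also have "\<dots> \<le> (\<integral>\<^sup>+x. ?G x \<partial>\<mu>)"
    proof (rule nn_integral_mono)
      fix x
      interpret P: prob_space "P x" by (rule P_prob)
      have "(\<integral>\<^sup>+y. ?V y \<partial>P x) \<le> ennreal (\<gamma> * V x + K)"
        by (rule order_trans[OF nn_integral_mono drift]) (auto intro: ennreal_leI)
      moreover have "(\<integral>\<^sup>+y. ?V y \<partial>P x) \<le> (\<integral>\<^sup>+y. ennreal M \<partial>P x)"
        by (intro nn_integral_mono) (auto intro: ennreal_leI)
      then have "(\<integral>\<^sup>+y. ?V y \<partial>P x) \<le> ennreal M" by (simp add: P.emeasure_space_1)
      ultimately show "(\<integral>\<^sup>+y. ?V y \<partial>P x) \<le> ?G x" by (auto simp: min_def)
    qed
    finally have V_le_G: "(\<integral>\<^sup>+x. ?V x \<partial>\<mu>) \<le> (\<integral>\<^sup>+x. ?G x \<partial>\<mu>)" .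
    have pointwise: "?G x + ennreal (1 - \<gamma>) * (ennreal (V x) * indicator {x. V x < M} x) \<le> ?V x + ennreal K" for x
    proof (cases "V x < M")
      case True
      have nn: "0 \<le> min (\<gamma> * V x + K) M" "0 \<le> (1 - \<gamma>) * V x" "0 \<le> min (V x) M"
        using V_nonneg[of x] \<gamma> K that by auto
      have "min (\<gamma> * V x + K) M + (1 - \<gamma>) * V x \<le> min (V x) M + K"
        using True by (auto simp: algebra_simps min_def)
      then have "ennreal (min (\<gamma> * V x + K) M + (1 - \<gamma>) * V x) \<le> ennreal (min (V x) M + K)"
        by (rule ennreal_leI)
      then show ?thesis
        using True nn \<gamma> K V_nonneg[of x] by (simp add: ennreal_plus ennreal_mult)
    next
      case False
      then have "?G x \<le> ?V x" by (intro ennreal_leI) auto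
      then show ?thesis using False by (simp add: add_increasing2)
    qed
    have "(\<integral>\<^sup>+x. ?G x \<partial>\<mu>) + ennreal (1 - \<gamma>) * ?I =
        (\<integral>\<^sup>+x. ?G x + ennreal (1 - \<gamma>) * (ennreal (V x) * indicator {x. V x < M} x) \<partial>\<mu>)"
      by (subst nn_integral_add) (auto simp: nn_integral_cmult)
    also have "\<dots> \<le> (\<integral>\<^sup>+x. ?V x + ennreal K \<partial>\<mu>)"
      by (intro nn_integral_mono pointwise)
    also have "\<dots> = (\<integral>\<^sup>+x. ?V x \<partial>\<mu>) + ennreal K"
      by (subst nn_integral_add) (auto simp: emeasure_space_1)
    also have "\<dots> \<le> (\<integral>\<^sup>+x. ?G x \<partial>\<mu>) + ennreal K"
      by (intro add_right_mono V_le_G)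
    finally have le: "(\<integral>\<^sup>+x. ?G x \<partial>\<mu>) + ennreal (1 - \<gamma>) * ?I \<le> (\<integral>\<^sup>+x. ?G x \<partial>\<mu>) + ennreal K" .
    have "(\<integral>\<^sup>+x. ?G x \<partial>\<mu>) \<le> (\<integral>\<^sup>+x. ennreal M \<partial>\<mu>)"
      by (intro nn_integral_mono) (auto intro: ennreal_leI)
    then have fin: "(\<integral>\<^sup>+x. ?G x \<partial>\<mu>) \<noteq> top"
      by (auto simp: emeasure_space_1 top_unique)
    have "ennreal (1 - \<gamma>) * ?I \<le> ennreal K"
      using le fin by (simp add: ennreal_add_left_cancel_le)
    then have "ennreal (1 / (1 - \<gamma>)) * (ennreal (1 - \<gamma>) * ?I) \<le> ennreal (1 / (1 - \<gamma>)) * ennreal K"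
      by (rule mult_left_mono) simp
    moreover have "ennreal (1 / (1 - \<gamma>)) * ennreal (1 - \<gamma>) = 1"
      using \<gamma> by (simp flip: ennreal_mult)
    moreover have "ennreal (1 / (1 - \<gamma>)) * ennreal K = ennreal (K / (1 - \<gamma>))"
      using \<gamma> K by (simp flip: ennreal_mult)
    ultimately show ?thesis by (simp flip: mult.assoc)
  qed
  have "(\<integral>\<^sup>+x. ennreal (V x) \<partial>\<mu>) =
      (\<integral>\<^sup>+x. liminf (\<lambda>n. ennreal (V x) * indicator {x. V x < real n} x) \<partial>\<mu>)"
  proof (intro nn_integral_cong lim_imp_Liminf[symmetric] tendsto_eventually)
    fix x
    show "\<forall>\<^sub>F n in sequentially. ennreal (V x) * indicator {x. V x < real n} x = ennreal (V x)"
      using eventually_gt_at_top[of "nat \<lceil>V x\<rceil>"] by eventually_elim (auto simp: indicator_def, linarith)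
  qed simp
  also have "\<dots> \<le> liminf (\<lambda>n. \<integral>\<^sup>+x. ennreal (V x) * indicator {x. V x < real n} x \<partial>\<mu>)"
    by (intro nn_integral_liminf) measurable
  also have "\<dots> \<le> liminf (\<lambda>_ :: nat. ennreal (K / (1 - \<gamma>)))"
    by (intro Liminf_mono always_eventually allI truncated) simp
  also have "\<dots> = ennreal (K / (1 - \<gamma>))" by (simp add: Liminf_const)
  finally show ?thesis .
qed

text \<open>The constant \<open>K / (1 - \<gamma>)\<close> is the fixed point of \<open>k \<mapsto> \<gamma> k + K\<close>, so the bound reproduces itself under one more step.\<close>

lemma nn_integral_lyapunov_kernel_pow_le:
  fixes P :: "'a::topological_space \<Rightarrow> 'a measure"
  assumes P: "P \<in> borel \<rightarrow>\<^sub>M prob_algebra borel" and V: "lyapunov_with P V \<gamma> K"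
  shows "(\<integral>\<^sup>+y. ennreal (V y) \<partial>kernel_pow P n x) \<le> ennreal (V x + K / (1 - \<gamma>))"
proof (induction n)
  case 0
  have "V x \<le> V x + K / (1 - \<gamma>)" using V by (simp add: lyapunov_with_def)
  then show ?case
    using V by (simp add: lyapunov_with_def nn_integral_return ennreal_leI del: ennreal_plus)
next
  case (Suc n)
  have V_meas[measurable]: "V \<in> borel_measurable borel" and V_nonneg: "\<And>x. 0 \<le> V x"
    and \<gamma>: "0 < \<gamma>" "\<gamma> < 1" and K: "0 < K"
    and drift: "\<And>x. (\<integral>\<^sup>+y. ennreal (V y) \<partial>P x) \<le> ennreal (\<gamma> * V x + K)"
    using V by (auto simp: lyapunov_with_def)
  note alg = kernel_pow_in_prob_algebra[OF P, of n x]
  interpret prob_space "kernel_pow P n x" using alg by (simp add: space_prob_algebra)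
  have sets[measurable_cong]: "sets (kernel_pow P n x) = sets borel" using alg by (simp add: space_prob_algebra)
  have "(\<integral>\<^sup>+y. ennreal (V y) \<partial>kernel_pow P (Suc n) x) = (\<integral>\<^sup>+y. \<integral>\<^sup>+z. ennreal (V z) \<partial>P y \<partial>kernel_pow P n x)"
    using measurable_prob_algebraD[OF P]
    by (simp, intro nn_integral_bind[of _ borel]) (auto simp: measurable_of_prob_algebra[OF alg])
  also have "\<dots> \<le> (\<integral>\<^sup>+y. ennreal (\<gamma> * V y + K) \<partial>kernel_pow P n x)"
    by (intro nn_integral_mono drift)
  also have "\<dots> = (\<integral>\<^sup>+y. ennreal \<gamma> * ennreal (V y) + ennreal K \<partial>kernel_pow P n x)"
    using \<gamma> K V_nonneg by (simp add: ennreal_mult)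
  also have "\<dots> = ennreal \<gamma> * (\<integral>\<^sup>+y. ennreal (V y) \<partial>kernel_pow P n x) + ennreal K"
    by (simp add: nn_integral_add nn_integral_cmult emeasure_space_1)
  also have "\<dots> \<le> ennreal \<gamma> * ennreal (V x + K / (1 - \<gamma>)) + ennreal K"
    by (intro add_right_mono mult_left_mono Suc) simp
  also have "\<dots> = ennreal (\<gamma> * (V x + K / (1 - \<gamma>)) + K)"
  proof -
    have "0 \<le> V x + K / (1 - \<gamma>)" using \<gamma> K V_nonneg[of x] by simp
    then show ?thesis
      using \<gamma> K ennreal_mult[of \<gamma> "V x + K / (1 - \<gamma>)"] ennreal_plus[of "\<gamma> * (V x + K / (1 - \<gamma>))" K]
      by (metis less_imp_le mult_nonneg_nonneg)
  qed
  also have "\<dots> \<le> ennreal (V x + K / (1 - \<gamma>))"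
  proof (rule ennreal_leI)
    have "K / (1 - \<gamma>) - \<gamma> * (K / (1 - \<gamma>)) = K"
      using \<gamma> by (simp add: divide_simps) (simp add: algebra_simps)
    moreover have "\<gamma> * V x \<le> V x" using \<gamma> V_nonneg[of x] by (simp add: mult_left_le_one_le)
    ultimately show "\<gamma> * (V x + K / (1 - \<gamma>)) + K \<le> V x + K / (1 - \<gamma>)"
      by (simp only: distrib_left)
  qed
  finally show ?case .
qed

lemma lyapunov_add_const:
  assumes P: "P \<in> borel \<rightarrow>\<^sub>M prob_algebra borel" and V: "lyapunov_with P V \<gamma> K" and k: "0 \<le> k"
  shows "lyapunov P (\<lambda>x. V x + k)"
proof -
  have V_meas[measurable]: "V \<in> borel_measurable borel" and V_nonneg: "\<And>x. 0 \<le> V x"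
    and \<gamma>: "0 < \<gamma>" "\<gamma> < 1" and K: "0 < K"
    and drift: "\<And>x. (\<integral>\<^sup>+y. ennreal (V y) \<partial>P x) \<le> ennreal (\<gamma> * V x + K)"
    using V by (auto simp: lyapunov_with_def)
  have "(\<integral>\<^sup>+y. ennreal (V y + k) \<partial>P x) \<le> ennreal (\<gamma> * (V x + k) + (K + k))" for x
  proof -
    interpret prob_space "P x" using measurable_space[OF P, of x] by (simp add: space_prob_algebra)
    have [measurable_cong]: "sets (P x) = sets borel"
      using measurable_space[OF P, of x] by (simp add: space_prob_algebra)
    have "(\<integral>\<^sup>+y. ennreal (V y + k) \<partial>P x) = (\<integral>\<^sup>+y. ennreal (V y) \<partial>P x) + ennreal k"
      using V_nonneg k by (simp add: nn_integral_add emeasure_space_1)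
    also have "\<dots> \<le> ennreal (\<gamma> * V x + K) + ennreal k"
      by (intro add_right_mono drift)
    also have "\<dots> = ennreal (\<gamma> * V x + K + k)"
      using \<gamma> K k V_nonneg[of x] by (simp add: ennreal_plus[symmetric] del: ennreal_plus)
    also have "\<dots> \<le> ennreal (\<gamma> * (V x + k) + (K + k))"
      using \<gamma> k by (intro ennreal_leI) (simp add: distrib_left)
    finally show ?thesis .
  qed
  then have "lyapunov_with P (\<lambda>x. V x + k) \<gamma> (K + k)"
    unfolding lyapunov_with_def using V_nonneg \<gamma> K k by (auto intro: add_nonneg_nonneg add_pos_nonneg)
  then show ?thesis unfolding lyapunov_def by blast
qed

section \<open>The weighted distance and the perturbation bounds\<close>

lemma lower_semicontinuous_sqrt_mult:
  fixes f w :: "'a::t2_space \<Rightarrow> real"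
  assumes f: "lower_semicontinuous f" "\<And>x. 0 \<le> f x" and w: "continuous_on UNIV w" "\<And>x. 0 < w x"
  shows "lower_semicontinuous (\<lambda>x. sqrt (f x * w x))"
  unfolding lower_semicontinuous_def
proof (intro allI impI)
  fix x a assume a: "a < sqrt (f x * w x)"
  show "\<forall>\<^sub>F y in nhds x. a < sqrt (f y * w y)"
  proof (cases "a < 0")
    case True
    have "a < sqrt (f y * w y)" for y
      using True f(2)[of y] w(2)[of y] real_sqrt_ge_zero[of "f y * w y"] by (auto intro: less_le_trans)
    then show ?thesis by simp
  next
    case False
    then have "a\<^sup>2 < f x * w x" using a real_sqrt_le_mono[of "f x * w x" "a\<^sup>2"] by force
    then have "a\<^sup>2 / w x < f x" using w(2) by (simp add: field_simps)
    then obtain m where m: "a\<^sup>2 / w x < m" "m < f x" using dense by blast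
    have "isCont (\<lambda>y. m * w y) x"
      using w(1) by (intro continuous_intros) (simp add: continuous_on_eq_continuous_within)
    then have "((\<lambda>y. m * w y) \<longlongrightarrow> m * w x) (nhds x)"
      using tendsto_at_iff_tendsto_nhds[of "\<lambda>y. m * w y" x] by (simp add: continuous_at)
    moreover have "a\<^sup>2 < m * w x" using m(1) w(2)[of x] by (simp add: field_simps)
    ultimately have "\<forall>\<^sub>F y in nhds x. a\<^sup>2 < m * w y" by (rule order_tendstoD)
    moreover have "\<forall>\<^sub>F y in nhds x. m < f y" using f(1) m(2) by (auto simp: lower_semicontinuous_def)
    ultimately show ?thesis
    proof eventually_elim
      case (elim y)
      then have "m * w y \<le> f y * w y" using w(2)[of y] by (intro mult_right_mono) auto
      with elim have "a\<^sup>2 < f y * w y" by simp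
      then show ?case by (rule real_less_rsqrt)
    qed
  qed
qed

lemma tilde_dist_lower_semicontinuous:
  fixes d :: "'a::t2_space \<Rightarrow> 'a \<Rightarrow> real"
  assumes V: "continuous_on UNIV V" "\<And>x. 0 \<le> V x" and d: "distance_like d" and \<beta>: "0 < \<beta>"
  shows "lower_semicontinuous (\<lambda>(x, y). tilde_dist d V \<beta> x y)"
proof -
  have "lower_semicontinuous (\<lambda>p. sqrt ((case p of (x, y) \<Rightarrow> d x y) * (2 + \<beta> * V (fst p) + \<beta> * V (snd p))))"
  proof (rule lower_semicontinuous_sqrt_mult)
    show "lower_semicontinuous (\<lambda>p. case p of (x, y) \<Rightarrow> d x y)"
      using d by (simp add: distance_like_def)
    show "0 \<le> (case p of (x, y) \<Rightarrow> d x y)" for p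
      using d by (auto simp: distance_like_def split: prod.splits)
    show "continuous_on UNIV (\<lambda>p. 2 + \<beta> * V (fst p) + \<beta> * V (snd p))"
      by (intro continuous_intros continuous_on_compose2[OF V(1)]) auto
    show "0 < 2 + \<beta> * V (fst p) + \<beta> * V (snd p)" for p
      using \<beta> V(2)[of "fst p"] V(2)[of "snd p"] by (simp add: add_pos_nonneg)
  qed
  moreover have "(\<lambda>p. sqrt ((case p of (x, y) \<Rightarrow> d x y) * (2 + \<beta> * V (fst p) + \<beta> * V (snd p)))) =
      (\<lambda>(x, y). tilde_dist d V \<beta> x y)"
    by (auto simp: tilde_dist_def fun_eq_iff)
  ultimately show ?thesis by simp
qed

lemma tilde_dist_le:
  assumes d: "0 \<le> d x y" "d x y \<le> 1" and V: "0 \<le> V x" "0 \<le> V y" and \<beta>: "0 < \<beta>"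
  shows "tilde_dist d V \<beta> x y \<le> 2 + \<beta> * V x + \<beta> * V y"
proof -
  let ?w = "2 + \<beta> * V x + \<beta> * V y"
  have w: "1 \<le> ?w" using \<beta> V by (simp add: add_increasing2)
  then have "d x y * ?w \<le> ?w * ?w" using d by (intro mult_right_mono) auto
  then have "sqrt (d x y * ?w) \<le> sqrt (?w * ?w)" by (rule real_sqrt_le_mono)
  then show ?thesis using w by (simp add: tilde_dist_def)
qed

text \<open>With \<open>C < 1\<close> the weak triangle inequality at \<open>z = y\<close> bounds the distance by \<open>C\<close> times itself. In part (b), \<open>C < 1\<close> is the
  only way for \<open>n = 0\<close> to satisfy \<open>\<alpha>^n < inverse C\<close>.\<close>

lemma tilde_dist_eq_0_if_less_one:
  assumes d: "distance_like d" and V: "\<And>x. 0 \<le> V x" and \<beta>: "0 < \<beta>"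
    and tri: "\<And>x y z. tilde_dist d V \<beta> x y \<le> C * (tilde_dist d V \<beta> x z + tilde_dist d V \<beta> z y)"
    and C: "C < 1"
  shows "tilde_dist d V \<beta> x y = 0"
proof -
  have nn: "0 \<le> tilde_dist d V \<beta> x y"
    using d V[of x] V[of y] \<beta> by (simp add: tilde_dist_def distance_like_def)
  have "tilde_dist d V \<beta> y y = 0" using d by (simp add: tilde_dist_def distance_like_def)
  with tri[of x y y] have "tilde_dist d V \<beta> x y \<le> C * tilde_dist d V \<beta> x y" by simp
  then have "(1 - C) * tilde_dist d V \<beta> x y \<le> 0" by (simp add: left_diff_distrib)
  then show ?thesis using C nn by (simp add: mult_le_0_iff)
qed

lemma nn_integral_affine:
  assumes \<mu>: "prob_space \<mu>" and W: "W \<in> borel_measurable \<mu>" "\<And>x. 0 \<le> W x" and k: "0 \<le> k" and \<delta>: "0 \<le> \<delta>"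
  shows "(\<integral>\<^sup>+x. ennreal (k * (1 + \<delta> * W x)) \<partial>\<mu>) = ennreal k * (1 + ennreal \<delta> * (\<integral>\<^sup>+x. ennreal (W x) \<partial>\<mu>))"
proof -
  interpret prob_space \<mu> by fact
  have "ennreal (k * (1 + \<delta> * W x)) = ennreal k * (1 + ennreal \<delta> * ennreal (W x))" for x
    using W(2)[of x] k \<delta> by (simp add: ennreal_mult)
  then show ?thesis
    using W(1) by (simp add: nn_integral_cmult nn_integral_add emeasure_space_1)
qed

lemma ennreal_le_divide_of_le_mult_add:
  fixes T R :: ennreal
  assumes T: "T < top" and a: "0 \<le> a" "a < 1" and le: "T \<le> ennreal a * T + R"
  shows "T \<le> ennreal (1 / (1 - a)) * R"
proof (cases R)
  case (real r)
  obtain t where t: "T = ennreal t" "0 \<le> t" using T by (cases T) auto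
  have "ennreal t \<le> ennreal (a * t + r)"
    using le a real t by (simp add: ennreal_mult ennreal_plus)
  then have "t \<le> a * t + r" using a real t by (subst (asm) ennreal_le_iff) auto
  then have "t \<le> 1 / (1 - a) * r" using a by (simp add: field_simps)
  then have "ennreal t \<le> ennreal (1 / (1 - a) * r)" by (rule ennreal_leI)
  then show ?thesis
    unfolding t(1) real(2) using a real(1) by (subst ennreal_mult[symmetric]) auto
qed (use a in \<open>simp add: ennreal_mult_top\<close>)

lemma sum_geometric_shift:
  fixes C \<alpha> :: real
  shows "(\<Sum>j=1..Suc n. C ^ j * \<alpha> ^ (j - 1)) = C * (\<alpha> * (\<Sum>j=1..n. C ^ j * \<alpha> ^ (j - 1)) + 1)"
proof (induction n)
  case (Suc n)
  have "(\<Sum>j=1..Suc (Suc n). C ^ j * \<alpha> ^ (j - 1)) =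
      (\<Sum>j=1..Suc n. C ^ j * \<alpha> ^ (j - 1)) + C ^ Suc (Suc n) * \<alpha> ^ Suc n" by simp
  also have "\<dots> = C * (\<alpha> * (\<Sum>j=1..n. C ^ j * \<alpha> ^ (j - 1)) + 1) + C * \<alpha> * (C ^ Suc n * \<alpha> ^ n)"
    by (simp only: Suc) simp
  also have "\<dots> = C * (\<alpha> * (\<Sum>j=1..Suc n. C ^ j * \<alpha> ^ (j - 1)) + 1)"
    by (simp add: algebra_simps)
  finally show ?case .
qed simp

theorem theorem3p13:
  fixes P P\<epsilon> :: "'a::polish_space \<Rightarrow> 'a measure"
    and V :: "'a \<Rightarrow> real"
    and d :: "'a \<Rightarrow> 'a \<Rightarrow> real"
    and \<gamma> K \<gamma>\<epsilon> K\<epsilon> \<beta> \<alpha> C \<epsilon> \<delta> :: real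
  assumes P: "P \<in> borel \<rightarrow>\<^sub>M prob_algebra borel"
    and P\<epsilon>: "P\<epsilon> \<in> borel \<rightarrow>\<^sub>M prob_algebra borel"
    and V_cont: "continuous_on UNIV V"
    and V_P: "lyapunov_with P V \<gamma> K"
    and V_P\<epsilon>: "lyapunov_with P\<epsilon> V \<gamma>\<epsilon> K\<epsilon>"
    and d: "distance_like d"
    and d_le_1: "\<And>x y. d x y \<le> 1"
    and \<beta>: "0 < \<beta>"
    and \<alpha>: "0 < \<alpha>" "\<alpha> < 1"
    and C: "0 < C"
    and contraction:
      "\<And>x y. tilde_dist_measure d V \<beta> (P x) (P y) \<le> ennreal (\<alpha> * tilde_dist d V \<beta> x y)"
    and weak_triangle:
      "\<And>x y z. tilde_dist d V \<beta> x y \<le> C * (tilde_dist d V \<beta> x z + tilde_dist d V \<beta> z y)"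
    and \<epsilon>: "0 < \<epsilon>"
    and \<delta>: "0 \<le> \<delta>"
  shows
    "(\<forall>(c :: nat \<Rightarrow> real) (W :: 'a \<Rightarrow> real).
        (\<forall>n. 0 \<le> c n) \<longrightarrow>
        lyapunov P W \<longrightarrow> lyapunov P\<epsilon> W \<longrightarrow>
        (\<forall>x. W x \<le> V x + K\<epsilon> / (1 - \<gamma>\<epsilon>)) \<longrightarrow>
        (\<forall>n>0. \<forall>x. tilde_dist_measure d V \<beta> (kernel_pow P n x) (kernel_pow P\<epsilon> n x)
                   \<le> ennreal (\<epsilon> * c n * (1 + \<delta> * W x))) \<longrightarrow>
        (\<forall>\<alpha>'. 0 < \<alpha>' \<and> \<alpha>' < 1 \<longrightarrow>
           (\<exists>n::nat. real n > (- ln C) * inverse (ln \<alpha>) \<and>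
              (\<forall>\<mu>\<in>space (prob_algebra borel). \<forall>\<nu>\<in>space (prob_algebra borel).
                 tilde_dist_measure d V \<beta> (\<nu> \<bind> kernel_pow P n) (\<mu> \<bind> kernel_pow P\<epsilon> n)
                 \<le> ennreal \<alpha>' * tilde_dist_measure d V \<beta> \<mu> \<nu>
                   + ennreal (\<epsilon> * C * c n) * (1 + ennreal \<delta> * (\<integral>\<^sup>+x. ennreal (W x) \<partial>\<mu>))))) \<and>
        (\<forall>\<mu> \<mu>\<epsilon>. invariant_prob P \<mu> \<and> invariant_prob P\<epsilon> \<mu>\<epsilon> \<longrightarrow>
           (\<forall>n::nat. \<alpha> ^ n < inverse C \<longrightarrow>
              tilde_dist_measure d V \<beta> \<mu> \<mu>\<epsilon>
              \<le> ennreal (C * \<epsilon> * c n / (1 - C * \<alpha> ^ n))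
                * (1 + ennreal \<delta> * (\<integral>\<^sup>+x. ennreal (W x) \<partial>\<mu>\<epsilon>))))) \<and>
     ((\<forall>x. tilde_dist_measure d V \<beta> (P x) (P\<epsilon> x) \<le> ennreal (\<epsilon> * (1 + \<delta> * V x))) \<longrightarrow>
        (\<exists>W :: 'a \<Rightarrow> real.
           lyapunov P W \<and> lyapunov P\<epsilon> W \<and>
           (\<forall>x. W x \<le> V x + K\<epsilon> / (1 - \<gamma>\<epsilon>)) \<and>
           (\<forall>n>0. \<forall>x. tilde_dist_measure d V \<beta> (kernel_pow P n x) (kernel_pow P\<epsilon> n x)
                      \<le> ennreal (\<epsilon> * (\<Sum>j=1..n. C ^ j * \<alpha> ^ (j - 1)) * (1 + \<delta> * W x)))))"
proof -
  let ?D = "\<lambda>(x, y). tilde_dist d V \<beta> x y"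
  let ?T = "tilde_dist_measure d V \<beta>"
  let ?A = "space (prob_algebra (borel :: 'a measure))"
  note T_eq = tilde_dist_measure_eq_transport_cost[of d V \<beta>]
  have V_meas[measurable]: "V \<in> borel_measurable borel" and V_nonneg: "\<And>x. 0 \<le> V x"
    using V_P by (auto simp: lyapunov_with_def)
  have d_nonneg: "0 \<le> d x y" and d_sym: "d x y = d y x" and d_refl: "d x x = 0" for x y
    using d by (auto simp: distance_like_def)
  have lsc: "lower_semicontinuous ?D"
    by (rule tilde_dist_lower_semicontinuous[OF V_cont V_nonneg d \<beta>])
  have D_borel: "?D \<in> borel_measurable borel" using lsc by (rule lower_semicontinuous_borel)
  have D_nonneg: "0 \<le> ?D p" for p
    using \<beta> V_nonneg d_nonneg by (auto simp: tilde_dist_def split: prod.splits)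
  have commute: "?T \<mu> \<nu> = ?T \<nu> \<mu>" if "\<mu> \<in> ?A" "\<nu> \<in> ?A" for \<mu> \<nu>
    unfolding T_eq using that
    by (rule transport_cost_commute[OF _ _ D_borel]) (simp add: tilde_dist_def d_sym ac_simps)
  have triangle: "?T \<mu> \<rho> \<le> ennreal C * (?T \<mu> \<nu> + ?T \<nu> \<rho>)" if "\<mu> \<in> ?A" "\<nu> \<in> ?A" "\<rho> \<in> ?A" for \<mu> \<nu> \<rho>
    unfolding T_eq
    by (rule transport_cost_weak_triangle[OF that D_borel D_borel D_borel D_nonneg D_nonneg C])
      (use weak_triangle in simp)
  have D_contraction: "transport_cost ?D (P x) (P y) \<le> ennreal (\<alpha> * ?D (x, y))" for x y
    using contraction[of x y] by (simp add: T_eq)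
  have mixture: "?T (\<mu> \<bind> Q) (\<mu> \<bind> R) \<le> ennreal k * (1 + ennreal \<delta> * (\<integral>\<^sup>+x. ennreal (W x) \<partial>\<mu>))"
    if \<mu>: "\<mu> \<in> ?A" and Q: "Q \<in> borel \<rightarrow>\<^sub>M prob_algebra borel" and R: "R \<in> borel \<rightarrow>\<^sub>M prob_algebra borel"
      and W: "W \<in> borel_measurable borel" "\<And>x. 0 \<le> W x" and k: "0 \<le> k"
      and le: "\<And>x. ?T (Q x) (R x) \<le> ennreal (k * (1 + \<delta> * W x))" for \<mu> Q R W k
  proof -
    have \<mu>_prob: "prob_space \<mu>" using \<mu> by (simp add: space_prob_algebra)
    have W_meas: "W \<in> borel_measurable \<mu>" using W(1) by (simp add: measurable_of_prob_algebra[OF \<mu>])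
    have "transport_cost ?D (\<mu> \<bind> Q) (\<mu> \<bind> R) \<le> (\<integral>\<^sup>+x. ennreal (k * (1 + \<delta> * W x)) \<partial>\<mu>)"
    proof (rule transport_cost_bind_le[OF \<mu>_prob _ _ lsc D_nonneg])
      show "Q \<in> \<mu> \<rightarrow>\<^sub>M prob_algebra borel" "R \<in> \<mu> \<rightarrow>\<^sub>M prob_algebra borel"
        using Q R by (simp_all add: measurable_of_prob_algebra[OF \<mu>])
      show "(\<lambda>x. k * (1 + \<delta> * W x)) \<in> borel_measurable \<mu>" using W_meas by measurable
      show "0 \<le> k * (1 + \<delta> * W x)" for x using k \<delta> W(2)[of x] by simp
      show "transport_cost ?D (Q x) (R x) \<le> ennreal (k * (1 + \<delta> * W x))" for x
        using le[of x] by (simp add: T_eq)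
    qed
    then show ?thesis
      by (simp add: T_eq nn_integral_affine[OF \<mu>_prob W_meas W(2) k \<delta>])
  qed
  have power_bound: "?T (\<nu> \<bind> kernel_pow P n) (\<mu> \<bind> kernel_pow P\<epsilon> n) \<le>
      ennreal (C * \<alpha> ^ n) * ?T \<nu> \<mu> + ennreal (\<epsilon> * C * c n) * (1 + ennreal \<delta> * (\<integral>\<^sup>+x. ennreal (W x) \<partial>\<mu>))"
    if c: "\<And>n. 0 \<le> c n" and W: "lyapunov P W"
      and le: "\<And>x. ?T (kernel_pow P n x) (kernel_pow P\<epsilon> n x) \<le> ennreal (\<epsilon> * c n * (1 + \<delta> * W x))"
      and alg: "\<mu> \<in> ?A" "\<nu> \<in> ?A" for c :: "nat \<Rightarrow> real" and W \<mu> \<nu> n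
  proof -
    let ?B = "1 + ennreal \<delta> * (\<integral>\<^sup>+x. ennreal (W x) \<partial>\<mu>)"
    have W': "W \<in> borel_measurable borel" "\<And>x. 0 \<le> W x"
      using W by (auto simp: lyapunov_def lyapunov_with_def)
    have pow_alg: "\<nu> \<bind> kernel_pow P n \<in> ?A" "\<mu> \<bind> kernel_pow P n \<in> ?A" "\<mu> \<bind> kernel_pow P\<epsilon> n \<in> ?A"
      using alg by (auto intro!: bind_in_prob_algebra kernel_pow_measurable P P\<epsilon>)
    have "?T (\<nu> \<bind> kernel_pow P n) (\<mu> \<bind> kernel_pow P\<epsilon> n) \<le>
        ennreal C * (?T (\<nu> \<bind> kernel_pow P n) (\<mu> \<bind> kernel_pow P n) + ?T (\<mu> \<bind> kernel_pow P n) (\<mu> \<bind> kernel_pow P\<epsilon> n))"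
      by (rule triangle[OF pow_alg])
    also have "\<dots> \<le> ennreal C * (ennreal (\<alpha> ^ n) * ?T \<nu> \<mu> + ennreal (\<epsilon> * c n) * ?B)"
    proof (intro mult_left_mono add_mono)
      show "?T (\<nu> \<bind> kernel_pow P n) (\<mu> \<bind> kernel_pow P n) \<le> ennreal (\<alpha> ^ n) * ?T \<nu> \<mu>"
        unfolding T_eq
        by (rule transport_cost_bind_kernel_pow_contraction[OF P alg(2,1) lsc D_nonneg \<alpha>(1) D_contraction])
      show "?T (\<mu> \<bind> kernel_pow P n) (\<mu> \<bind> kernel_pow P\<epsilon> n) \<le> ennreal (\<epsilon> * c n) * ?B"
        using \<epsilon> c by (intro mixture[OF alg(1) kernel_pow_measurable[OF P] kernel_pow_measurable[OF P\<epsilon>] W' _ le]) simp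
    qed simp
    also have "\<dots> = (ennreal C * ennreal (\<alpha> ^ n)) * ?T \<nu> \<mu> + (ennreal C * ennreal (\<epsilon> * c n)) * ?B"
      by (simp only: distrib_left[of "ennreal C"] mult.assoc)
    also have "ennreal C * ennreal (\<alpha> ^ n) = ennreal (C * \<alpha> ^ n)"
      using C \<alpha> by (intro ennreal_mult[symmetric]) auto
    also have "ennreal C * ennreal (\<epsilon> * c n) = ennreal (\<epsilon> * C * c n)"
      using C \<epsilon> c by (subst ennreal_mult[symmetric]) (auto simp: ac_simps)
    finally show ?thesis .
  qed
  have part_a: "\<exists>n::nat. real n > (- ln C) * inverse (ln \<alpha>) \<and>
              (\<forall>\<mu>\<in>?A. \<forall>\<nu>\<in>?A.
                 ?T (\<nu> \<bind> kernel_pow P n) (\<mu> \<bind> kernel_pow P\<epsilon> n)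
                 \<le> ennreal \<alpha>' * ?T \<mu> \<nu>
                   + ennreal (\<epsilon> * C * c n) * (1 + ennreal \<delta> * (\<integral>\<^sup>+x. ennreal (W x) \<partial>\<mu>)))"
    if c: "\<And>n. 0 \<le> c n" and W: "lyapunov P W"
      and le: "\<And>n x. 0 < n \<Longrightarrow> ?T (kernel_pow P n x) (kernel_pow P\<epsilon> n x) \<le> ennreal (\<epsilon> * c n * (1 + \<delta> * W x))"
      and \<alpha>': "0 < \<alpha>'" for c :: "nat \<Rightarrow> real" and W \<alpha>'
  proof -
    have "(\<lambda>n. C * \<alpha> ^ n) \<longlonglongrightarrow> C * 0"
      using \<alpha> by (intro tendsto_mult_left LIMSEQ_realpow_zero) auto
    then have "eventually (\<lambda>n. C * \<alpha> ^ n < \<alpha>') sequentially"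
      using \<alpha>' by (intro order_tendstoD(2)) auto
    moreover have "eventually (\<lambda>n. real n > (- ln C) * inverse (ln \<alpha>)) sequentially"
      using filterlim_real_sequentially by (rule filterlim_at_top_dense[THEN iffD1, THEN spec])
    ultimately have "eventually (\<lambda>n. C * \<alpha> ^ n < \<alpha>' \<and> real n > (- ln C) * inverse (ln \<alpha>) \<and> 0 < n) sequentially"
      using eventually_gt_at_top[of 0] by eventually_elim auto
    then obtain n where n: "C * \<alpha> ^ n < \<alpha>'" "real n > (- ln C) * inverse (ln \<alpha>)" "0 < n"
      by (auto simp: eventually_sequentially)
    have "?T (\<nu> \<bind> kernel_pow P n) (\<mu> \<bind> kernel_pow P\<epsilon> n)
        \<le> ennreal \<alpha>' * ?T \<mu> \<nu> + ennreal (\<epsilon> * C * c n) * (1 + ennreal \<delta> * (\<integral>\<^sup>+x. ennreal (W x) \<partial>\<mu>))"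
      if alg: "\<mu> \<in> ?A" "\<nu> \<in> ?A" for \<mu> \<nu>
    proof (rule order_trans[OF power_bound[where W = W and c = c, OF c W le[OF n(3)] alg]])
      have "ennreal (C * \<alpha> ^ n) * ?T \<nu> \<mu> \<le> ennreal \<alpha>' * ?T \<nu> \<mu>"
        using n(1) by (intro mult_right_mono ennreal_leI) auto
      then show "ennreal (C * \<alpha> ^ n) * ?T \<nu> \<mu> + ennreal (\<epsilon> * C * c n) * (1 + ennreal \<delta> * (\<integral>\<^sup>+x. ennreal (W x) \<partial>\<mu>))
          \<le> ennreal \<alpha>' * ?T \<mu> \<nu> + ennreal (\<epsilon> * C * c n) * (1 + ennreal \<delta> * (\<integral>\<^sup>+x. ennreal (W x) \<partial>\<mu>))"
        unfolding commute[OF alg] by (rule add_right_mono)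
    qed
    with n(2) show ?thesis by blast
  qed
  have finite_distance: "?T \<mu> \<mu>\<epsilon> < top" if \<mu>: "invariant_prob P \<mu>" and \<mu>\<epsilon>: "invariant_prob P\<epsilon> \<mu>\<epsilon>" for \<mu> \<mu>\<epsilon>
  proof -
    have alg: "\<mu> \<in> ?A" "\<mu>\<epsilon> \<in> ?A" using \<mu> \<mu>\<epsilon> by (auto simp: invariant_prob_def)
    have sets: "sets \<mu> = sets borel" "sets \<mu>\<epsilon> = sets borel" using alg by (auto simp: space_prob_algebra)
    let ?\<Gamma> = "\<mu> \<Otimes>\<^sub>M \<mu>\<epsilon>"
    have \<Gamma>: "?\<Gamma> \<in> couplings \<mu> \<mu>\<epsilon>" by (rule pair_measure_coupling[OF alg])
    have \<Gamma>_alg: "?\<Gamma> \<in> space (prob_algebra borel)" by (rule couplingsD(1)[OF \<Gamma> sets])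
    have marginals: "distr ?\<Gamma> borel fst = \<mu>" "distr ?\<Gamma> borel snd = \<mu>\<epsilon>"
      using couplingsD(2,3)[OF \<Gamma> sets] by auto
    interpret \<Gamma>: prob_space ?\<Gamma> using \<Gamma>_alg by (simp add: space_prob_algebra)
    have proj: "fst \<in> ?\<Gamma> \<rightarrow>\<^sub>M borel" "snd \<in> ?\<Gamma> \<rightarrow>\<^sub>M borel"
      unfolding measurable_of_prob_algebra[OF \<Gamma>_alg] by (auto simp: borel_prod[symmetric])
    have V_proj[measurable]: "(\<lambda>p. V (fst p)) \<in> borel_measurable ?\<Gamma>" "(\<lambda>p. V (snd p)) \<in> borel_measurable ?\<Gamma>"
      using measurable_compose[OF proj(1) V_meas] measurable_compose[OF proj(2) V_meas] .
    have "?T \<mu> \<mu>\<epsilon> \<le> (\<integral>\<^sup>+p. ennreal (?D p) \<partial>?\<Gamma>)"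
      unfolding T_eq by (rule transport_cost_le[OF \<Gamma>])
    also have "\<dots> \<le> (\<integral>\<^sup>+p. 2 + ennreal \<beta> * ennreal (V (fst p)) + ennreal \<beta> * ennreal (V (snd p)) \<partial>?\<Gamma>)"
    proof (rule nn_integral_mono)
      fix p :: "'a \<times> 'a"
      have "ennreal (?D p) \<le> ennreal (2 + \<beta> * V (fst p) + \<beta> * V (snd p))"
        using tilde_dist_le[of d "fst p" "snd p" V \<beta>] d_nonneg d_le_1 V_nonneg \<beta>
        by (intro ennreal_leI) (simp add: case_prod_beta)
      also have "\<dots> = 2 + ennreal \<beta> * ennreal (V (fst p)) + ennreal \<beta> * ennreal (V (snd p))"
        using \<beta> V_nonneg by (simp add: ennreal_mult)
      finally show "ennreal (?D p) \<le> \<dots>" .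
    qed
    also have "\<dots> = 2 + ennreal \<beta> * (\<integral>\<^sup>+p. ennreal (V (fst p)) \<partial>?\<Gamma>) + ennreal \<beta> * (\<integral>\<^sup>+p. ennreal (V (snd p)) \<partial>?\<Gamma>)"
      by (simp add: nn_integral_add nn_integral_cmult \<Gamma>.emeasure_space_1)
    also have "(\<integral>\<^sup>+p. ennreal (V (fst p)) \<partial>?\<Gamma>) = (\<integral>\<^sup>+x. ennreal (V x) \<partial>distr ?\<Gamma> borel fst)"
      using proj by (subst nn_integral_distr) auto
    also have "\<dots> = (\<integral>\<^sup>+x. ennreal (V x) \<partial>\<mu>)" by (simp only: marginals)
    also have "(\<integral>\<^sup>+p. ennreal (V (snd p)) \<partial>?\<Gamma>) = (\<integral>\<^sup>+x. ennreal (V x) \<partial>distr ?\<Gamma> borel snd)"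
      using proj by (subst nn_integral_distr) auto
    also have "\<dots> = (\<integral>\<^sup>+x. ennreal (V x) \<partial>\<mu>\<epsilon>)" by (simp only: marginals)
    also have "2 + ennreal \<beta> * (\<integral>\<^sup>+x. ennreal (V x) \<partial>\<mu>) + ennreal \<beta> * (\<integral>\<^sup>+x. ennreal (V x) \<partial>\<mu>\<epsilon>) < top"
      using le_less_trans[OF nn_integral_lyapunov_invariant_le[OF P \<mu> V_P] ennreal_less_top]
        le_less_trans[OF nn_integral_lyapunov_invariant_le[OF P\<epsilon> \<mu>\<epsilon> V_P\<epsilon>] ennreal_less_top]
      by (simp add: ennreal_mult_less_top less_top[symmetric] ennreal_add_eq_top ennreal_mult_eq_top_iff)
    finally show ?thesis .
  qed
  have part_b: "?T \<mu> \<mu>\<epsilon> \<le> ennreal (C * \<epsilon> * c n / (1 - C * \<alpha> ^ n)) * (1 + ennreal \<delta> * (\<integral>\<^sup>+x. ennreal (W x) \<partial>\<mu>\<epsilon>))"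
    if c: "\<And>n. 0 \<le> c n" and W: "lyapunov P W"
      and le: "\<And>n x. 0 < n \<Longrightarrow> ?T (kernel_pow P n x) (kernel_pow P\<epsilon> n x) \<le> ennreal (\<epsilon> * c n * (1 + \<delta> * W x))"
      and \<mu>: "invariant_prob P \<mu>" and \<mu>\<epsilon>: "invariant_prob P\<epsilon> \<mu>\<epsilon>"
      and n: "\<alpha> ^ n < inverse C" for c :: "nat \<Rightarrow> real" and W \<mu> \<mu>\<epsilon> n
  proof -
    let ?B = "1 + ennreal \<delta> * (\<integral>\<^sup>+x. ennreal (W x) \<partial>\<mu>\<epsilon>)"
    have alg: "\<mu> \<in> ?A" "\<mu>\<epsilon> \<in> ?A" using \<mu> \<mu>\<epsilon> by (auto simp: invariant_prob_def)
    have C\<alpha>: "0 \<le> C * \<alpha> ^ n" "C * \<alpha> ^ n < 1"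
      using C \<alpha> n by (auto simp: field_simps)
    show ?thesis
    proof (cases "n = 0")
      case True
      then have "C < 1" using C\<alpha> by simp
      then have "?D p = 0" for p
        using tilde_dist_eq_0_if_less_one[OF d V_nonneg \<beta> weak_triangle] by (simp add: case_prod_beta)
      then have "?T \<mu> \<mu>\<epsilon> = 0"
        using transport_cost_le[OF pair_measure_coupling[OF alg], of ?D] by (simp add: T_eq)
      then show ?thesis by simp
    next
      case False
      then have "0 < n" by simp
      then have "?T \<mu> \<mu>\<epsilon> \<le> ennreal (C * \<alpha> ^ n) * ?T \<mu> \<mu>\<epsilon> + ennreal (\<epsilon> * C * c n) * ?B"
        using power_bound[where n = n and c = c and W = W, OF c W le[OF \<open>0 < n\<close>] alg(2,1)]
        by (simp add: bind_invariant_kernel_pow[OF P \<mu>] bind_invariant_kernel_pow[OF P\<epsilon> \<mu>\<epsilon>])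
      then have "?T \<mu> \<mu>\<epsilon> \<le> ennreal (1 / (1 - C * \<alpha> ^ n)) * (ennreal (\<epsilon> * C * c n) * ?B)"
        by (rule ennreal_le_divide_of_le_mult_add[OF finite_distance[OF \<mu> \<mu>\<epsilon>] C\<alpha>])
      also have "\<dots> = (ennreal (1 / (1 - C * \<alpha> ^ n)) * ennreal (\<epsilon> * C * c n)) * ?B"
        by (simp only: mult.assoc)
      also have "ennreal (1 / (1 - C * \<alpha> ^ n)) * ennreal (\<epsilon> * C * c n) = ennreal (C * \<epsilon> * c n / (1 - C * \<alpha> ^ n))"
        using C\<alpha> C \<epsilon> c by (subst ennreal_mult[symmetric]) (auto simp: ac_simps)
      finally show ?thesis .
    qed
  qed
  have part_c: "\<exists>W. lyapunov P W \<and> lyapunov P\<epsilon> W \<and> (\<forall>x. W x \<le> V x + K\<epsilon> / (1 - \<gamma>\<epsilon>)) \<and>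
      (\<forall>n>0. \<forall>x. ?T (kernel_pow P n x) (kernel_pow P\<epsilon> n x)
        \<le> ennreal (\<epsilon> * (\<Sum>j=1..n. C ^ j * \<alpha> ^ (j - 1)) * (1 + \<delta> * W x)))"
    if le: "\<And>x. ?T (P x) (P\<epsilon> x) \<le> ennreal (\<epsilon> * (1 + \<delta> * V x))"
  proof -
    \<comment> \<open>Adding the constant keeps the drift condition for both kernels, with a larger additive constant.\<close>
    define k where "k = K\<epsilon> / (1 - \<gamma>\<epsilon>)"
    have k: "0 \<le> k" using V_P\<epsilon> by (simp add: k_def lyapunov_with_def)
    define W where "W = (\<lambda>x. V x + k)"
    define s where "s n = (\<Sum>j=1..n. C ^ j * \<alpha> ^ (j - 1))" for n
    have s_nonneg: "0 \<le> s n" for n using C \<alpha> by (auto simp: s_def intro!: sum_nonneg)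
    have W_nonneg: "0 \<le> W x" for x using V_nonneg[of x] k by (simp add: W_def)
    have "?T (kernel_pow P n x) (kernel_pow P\<epsilon> n x) \<le> ennreal (\<epsilon> * s n * (1 + \<delta> * W x))" for n x
    proof (induction n)
      case 0
      have "return borel x \<in> ?A" by (simp add: space_prob_algebra prob_space_return)
      then have "?T (return borel x) (return borel x) = 0"
        unfolding T_eq by (rule transport_cost_self[OF _ D_borel]) (simp add: tilde_dist_def d_refl)
      then show ?case by simp
    next
      case (Suc n)
      let ?\<mu> = "kernel_pow P n x" and ?\<mu>\<epsilon> = "kernel_pow P\<epsilon> n x"
      note alg = kernel_pow_in_prob_algebra[OF P, of n x] kernel_pow_in_prob_algebra[OF P\<epsilon>, of n x]
      have w: "0 \<le> 1 + \<delta> * W x" using \<delta> W_nonneg[of x] by simp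
      have "?T (?\<mu> \<bind> P) (?\<mu>\<epsilon> \<bind> P\<epsilon>) \<le> ennreal C * (?T (?\<mu> \<bind> P) (?\<mu>\<epsilon> \<bind> P) + ?T (?\<mu>\<epsilon> \<bind> P) (?\<mu>\<epsilon> \<bind> P\<epsilon>))"
        by (rule triangle[OF bind_in_prob_algebra[OF alg(1) P] bind_in_prob_algebra[OF alg(2) P]
              bind_in_prob_algebra[OF alg(2) P\<epsilon>]])
      also have "\<dots> \<le> ennreal C * (ennreal (\<alpha> * (\<epsilon> * s n * (1 + \<delta> * W x))) + ennreal (\<epsilon> * (1 + \<delta> * W x)))"
      proof (intro mult_left_mono add_mono)
        have "?T (?\<mu> \<bind> P) (?\<mu>\<epsilon> \<bind> P) \<le> ennreal \<alpha> * ?T ?\<mu> ?\<mu>\<epsilon>"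
          unfolding T_eq by (rule transport_cost_bind_contraction[OF P alg lsc D_nonneg \<alpha>(1) D_contraction])
        also have "\<dots> \<le> ennreal \<alpha> * ennreal (\<epsilon> * s n * (1 + \<delta> * W x))"
          by (rule mult_left_mono[OF Suc]) simp
        also have "\<dots> = ennreal (\<alpha> * (\<epsilon> * s n * (1 + \<delta> * W x)))"
          using \<alpha> \<epsilon> s_nonneg w by (intro ennreal_mult[symmetric] mult_nonneg_nonneg) auto
        finally show "?T (?\<mu> \<bind> P) (?\<mu>\<epsilon> \<bind> P) \<le> \<dots>" .
        have "?T (?\<mu>\<epsilon> \<bind> P) (?\<mu>\<epsilon> \<bind> P\<epsilon>) \<le> ennreal \<epsilon> * (1 + ennreal \<delta> * (\<integral>\<^sup>+y. ennreal (V y) \<partial>?\<mu>\<epsilon>))"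
          by (rule mixture[OF alg(2) P P\<epsilon> V_meas V_nonneg _ le]) (use \<epsilon> in simp)
        also have "\<dots> \<le> ennreal \<epsilon> * (1 + ennreal \<delta> * ennreal (W x))"
          using nn_integral_lyapunov_kernel_pow_le[OF P\<epsilon> V_P\<epsilon>, of n x]
          by (intro mult_left_mono add_left_mono) (auto simp: W_def k_def)
        also have "\<dots> = ennreal (\<epsilon> * (1 + \<delta> * W x))"
          using \<epsilon> \<delta> W_nonneg[of x] by (simp add: ennreal_mult)
        finally show "?T (?\<mu>\<epsilon> \<bind> P) (?\<mu>\<epsilon> \<bind> P\<epsilon>) \<le> \<dots>" .
      qed simp
      also have "\<dots> = ennreal (C * (\<alpha> * (\<epsilon> * s n * (1 + \<delta> * W x)) + \<epsilon> * (1 + \<delta> * W x)))"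
        using C \<alpha> \<epsilon> s_nonneg[of n] w by (subst ennreal_plus[symmetric], simp, simp, subst ennreal_mult[symmetric]) auto
      also have "C * (\<alpha> * (\<epsilon> * s n * (1 + \<delta> * W x)) + \<epsilon> * (1 + \<delta> * W x)) = \<epsilon> * (C * (\<alpha> * s n + 1)) * (1 + \<delta> * W x)"
        by (simp add: algebra_simps)
      also have "C * (\<alpha> * s n + 1) = s (Suc n)"
        unfolding s_def by (rule sum_geometric_shift[symmetric])
      finally show ?case by simp
    qed
    then show ?thesis
      using lyapunov_add_const[OF P V_P k] lyapunov_add_const[OF P\<epsilon> V_P\<epsilon> k]
      unfolding W_def k_def s_def
      by (intro exI[of _ "\<lambda>x. V x + K\<epsilon> / (1 - \<gamma>\<epsilon>)"] conjI allI impI) simp_all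
  qed
  show ?thesis
    by (intro conjI allI impI; (elim conjE)?; rule part_a part_b part_c; simp)
qed

end
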